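(* Let $X$ be a real $L^1$-predual space. If the norm of $X$ is strongly subdifferentiable (SSD) at every unit vector of $X$, then the norm of $X$ is quasi-polyhedral. Hence $X$ is a quasi-polyhedral space whose dual $X^\ast$ is linearly isometric to $\ell^1(\Gamma)$ for some discrete set $\Gamma$.
   Context: A real $L^1$-predual space is a real Banach space $X$ whose dual $X^\ast$ is linearly isometric to $L^1(\mu)$ for some positive measure $\mu$. SSD: the norm of $X$ is strongly subdifferentiable at a unit vector $x$ if the limit $\lim_{t\to 0^+}\frac{\|x+ty\|-\|x\|}{t}$ exists uniformly for $y$ in the closed unit ball of $X$. For $x$ in the unit sphere $S_X$, let $S_x=\{x^\ast\in S_{X^\ast}: x^\ast(x)=1\}$ be the state space of $x$. The norm of $X$ is quasi-polyhedral (and $X$ is called a quasi-polyhedral space) if for every $x\in S_X$ there is $\delta>0$ such that for all $y\in S_X$ with $\|y-x\|<\delta$ one has $S_y\subset S_x$. *)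

theory Defs
  imports "HOL-Analysis.Analysis"
begin

text \<open>
  The dual of a real normed space \<open>'a\<close> is the type \<open>'a \<Rightarrow>\<^sub>L real\<close> with its operator norm.

  \<open>L\<^sup>1(M)\<close> is the space of integrable functions modulo equality almost everywhere.  A linear
  isometry of \<open>L\<^sup>1(M)\<close> onto \<open>'b\<close> is given by its lift \<open>T\<close> to integrable functions; the norm
  condition makes \<open>T\<close> respect equality almost everywhere.  Values of \<open>T\<close> at non-integrable
  functions are irrelevant.
\<close>

definition isometric_to_L1 :: "'b::real_normed_vector itself \<Rightarrow> 'm measure \<Rightarrow> bool" where
  "isometric_to_L1 _ M \<longleftrightarrow>
    (\<exists>T :: ('m \<Rightarrow> real) \<Rightarrow> 'b.
       (\<forall>f g. integrable M f \<longrightarrow> integrable M g \<longrightarrow> T (\<lambda>s. f s + g s) = T f + T g) \<and>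
       (\<forall>c f. integrable M f \<longrightarrow> T (\<lambda>s. c * f s) = c *\<^sub>R T f) \<and>
       (\<forall>f. integrable M f \<longrightarrow> norm (T f) = (LINT s|M. \<bar>f s\<bar>)) \<and>
       T ` {f. integrable M f} = UNIV)"

text \<open>
  The type of points of the underlying measure space is a parameter, since one cannot quantify
  over types inside a formula.
\<close>

definition L1_predual :: "'a::banach itself \<Rightarrow> 'm itself \<Rightarrow> bool" where
  "L1_predual _ _ \<longleftrightarrow> (\<exists>M :: 'm measure. isometric_to_L1 TYPE('a \<Rightarrow>\<^sub>L real) M)"

text \<open>Elements of \<open>\<ell>\<^sup>1(\<Gamma>)\<close> are represented as functions vanishing off \<open>\<Gamma>\<close>.\<close>

definition l1_space :: "'g set \<Rightarrow> ('g \<Rightarrow> real) set" where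
  "l1_space \<Gamma> = {f. (\<forall>i. i \<notin> \<Gamma> \<longrightarrow> f i = 0) \<and> (\<lambda>i. \<bar>f i\<bar>) summable_on \<Gamma>}"

definition isometric_to_l1 :: "'b::real_normed_vector itself \<Rightarrow> 'g set \<Rightarrow> bool" where
  "isometric_to_l1 _ \<Gamma> \<longleftrightarrow>
    (\<exists>T :: ('g \<Rightarrow> real) \<Rightarrow> 'b.
       (\<forall>f\<in>l1_space \<Gamma>. \<forall>g\<in>l1_space \<Gamma>. T (\<lambda>i. f i + g i) = T f + T g) \<and>
       (\<forall>c. \<forall>f\<in>l1_space \<Gamma>. T (\<lambda>i. c * f i) = c *\<^sub>R T f) \<and>
       (\<forall>f\<in>l1_space \<Gamma>. norm (T f) = (\<Sum>\<^sub>\<infinity>i\<in>\<Gamma>. \<bar>f i\<bar>)) \<and>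
       T ` l1_space \<Gamma> = UNIV)"

definition ssd_at :: "'a::real_normed_vector \<Rightarrow> bool" where
  "ssd_at x \<longleftrightarrow>
    (\<exists>l. uniform_limit (cball 0 1) (\<lambda>t y. (norm (x + t *\<^sub>R y) - norm x) / t) l (at_right 0))"

definition state_space :: "'a::real_normed_vector \<Rightarrow> ('a \<Rightarrow>\<^sub>L real) set" where
  "state_space x = {f. norm f = 1 \<and> blinfun_apply f x = 1}"

definition quasi_polyhedral :: "'a::real_normed_vector itself \<Rightarrow> bool" where
  "quasi_polyhedral _ \<longleftrightarrow>
    (\<forall>x::'a. norm x = 1 \<longrightarrow>
      (\<exists>\<delta>>0. \<forall>y. norm y = 1 \<and> norm (y - x) < \<delta> \<longrightarrow> state_space y \<subseteq> state_space x))"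

text \<open>
  If the dual of \<open>'a\<close> is linearly isometric to \<open>\<ell>\<^sup>1(\<Gamma>)\<close> for some set \<open>\<Gamma>\<close> of any type, the images
  of the unit vectors embed \<open>\<Gamma>\<close> in the dual, so restricting to subsets of the dual loses nothing.
\<close>

definition dual_is_l1 :: "'a::real_normed_vector itself \<Rightarrow> bool" where
  "dual_is_l1 _ \<longleftrightarrow> (\<exists>\<Gamma> :: ('a \<Rightarrow>\<^sub>L real) set. isometric_to_l1 TYPE('a \<Rightarrow>\<^sub>L real) \<Gamma>)"

end

theory Submission
  imports Defs
begin

text \<open>
  By Hahn--Banach, strong subdifferentiability at \<open>x\<close> means that functionals of norm \<open>1\<close> whose
  value at \<open>x\<close> is close to \<open>1\<close> are norm-close to \<open>state_space x\<close>. In an \<open>L\<^sup>1\<close>-space, two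
  normalized functions at distance less than \<open>2\<close> share a nonzero part (their median with \<open>0\<close>), and
  a part of a functional attaining its norm at \<open>x\<close> again attains its norm at \<open>x\<close>. Hence a state of
  \<open>y\<close>, for \<open>y\<close> near \<open>x\<close>, has no part that is singular to the states of \<open>x\<close>, which gives
  quasi-polyhedrality.

  The same principle excludes an atomless part of the measure: Bishop--Phelps provides unit vectors
  \<open>z\<^sub>n\<close> behaving like Rademacher functions on it, and strong subdifferentiability fails at
  \<open>\<Sum>n. 2\<^bsup>-(n+1)\<^esup> z\<^sub>n\<close>. Therefore every nonnegative integrable function dominates
  an atom and is a countable sum of atoms, which form the basis of \<open>\<ell>\<^sup>1(\<Gamma>)\<close>.
\<close>

section \<open>Hahn--Banach and almost maximal points\<close>

text \<open>Homogeneity is asked only as an inequality for \<open>t > 0\<close>, which passes to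
  infima; equality follows by scaling back with the inverse of \<open>t\<close>.\<close>

definition sublinear :: "('a::real_vector \<Rightarrow> real) \<Rightarrow> bool" where
  "sublinear q \<longleftrightarrow> (\<forall>x y. q (x + y) \<le> q x + q y) \<and> (\<forall>t>0. \<forall>x. q (t *\<^sub>R x) \<le> t * q x)"

lemma sublinear_add: "sublinear q \<Longrightarrow> q (x + y) \<le> q x + q y"
  by (simp add: sublinear_def)

lemma sublinear_0:
  assumes "sublinear q" shows "q 0 = 0"
proof -
  have "q (2 *\<^sub>R 0) \<le> 2 * q 0" "q ((1/2) *\<^sub>R 0) \<le> (1/2) * q 0"
    using assms unfolding sublinear_def by (meson zero_less_numeral half_gt_zero_iff zero_less_one)+
  then show ?thesis by simp
qed

lemma sublinear_scaleR:
  assumes "sublinear q" "t \<ge> 0" shows "q (t *\<^sub>R x) = t * q x"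
proof (cases "t = 0")
  case True
  then show ?thesis using sublinear_0[OF assms(1)] by simp
next
  case False
  with assms have t: "t > 0" by simp
  have "q (inverse t *\<^sub>R (t *\<^sub>R x)) \<le> inverse t * q (t *\<^sub>R x)"
    using assms(1) t unfolding sublinear_def by (meson positive_imp_inverse_positive)
  then have "t * q x \<le> q (t *\<^sub>R x)" using t by (simp add: field_simps)
  moreover have "q (t *\<^sub>R x) \<le> t * q x" using assms(1) t unfolding sublinear_def by blast
  ultimately show ?thesis by simp
qed

lemma sublinear_minus: "sublinear q \<Longrightarrow> - q (- x) \<le> q x"
  using sublinear_add[of q x "- x"] sublinear_0[of q] by simp

text \<open>Two indices need only be dominated by a third one, so this covers chains as well as
  infimal convolutions over a convex cone.\<close>

lemma sublinear_INF:
  fixes F :: "'i \<Rightarrow> 'a::real_vector \<Rightarrow> real"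
  assumes ne: "I \<noteq> {}"
    and bdd: "\<And>y. bdd_below ((\<lambda>i. F i y) ` I)"
    and add: "\<And>i j y z. i \<in> I \<Longrightarrow> j \<in> I \<Longrightarrow> \<exists>k\<in>I. F k (y + z) \<le> F i y + F j z"
    and scale: "\<And>i t y. i \<in> I \<Longrightarrow> t > 0 \<Longrightarrow> \<exists>k\<in>I. F k (t *\<^sub>R y) \<le> t * F i y"
  shows "sublinear (\<lambda>y. INF i\<in>I. F i y)"
  unfolding sublinear_def
proof (intro conjI allI impI)
  fix y z
  have *: "(INF k\<in>I. F k (y + z)) \<le> F i y + F j z" if "i \<in> I" "j \<in> I" for i j
    using add[OF that, of y z] bdd[of "y + z"] by (meson cINF_lower order_trans)
  have "(INF k\<in>I. F k (y + z)) - F i y \<le> (INF j\<in>I. F j z)" if "i \<in> I" for i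
    using *[OF that] by (intro cINF_greatest ne) (simp add: algebra_simps)
  then have "(INF k\<in>I. F k (y + z)) - (INF j\<in>I. F j z) \<le> (INF i\<in>I. F i y)"
    by (intro cINF_greatest ne) (simp add: algebra_simps)
  then show "(INF k\<in>I. F k (y + z)) \<le> (INF i\<in>I. F i y) + (INF j\<in>I. F j z)" by simp
next
  fix t :: real and y assume t: "t > 0"
  have *: "(INF k\<in>I. F k (t *\<^sub>R y)) \<le> t * F i y" if "i \<in> I" for i
    using scale[OF that t, of y] bdd[of "t *\<^sub>R y"] by (meson cINF_lower order_trans)
  have "(INF k\<in>I. F k (t *\<^sub>R y)) / t \<le> (INF i\<in>I. F i y)"
    using * t by (intro cINF_greatest ne) (simp add: field_simps)
  then show "(INF k\<in>I. F k (t *\<^sub>R y)) \<le> t * (INF i\<in>I. F i y)"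
    using t by (simp add: field_simps)
qed

text \<open>Lowering \<open>q\<close> to the infimum of \<open>q (y + t x) - t q x\<close> over
  \<open>t \<ge> 0\<close> keeps it sublinear, so minimality says that nothing changes; the index
  \<open>t = 1\<close> at \<open>- x\<close> then yields \<open>q (- x) \<le> - q x\<close>.\<close>

lemma minimal_sublinear_odd:
  assumes q: "sublinear q" and min: "\<And>r. sublinear r \<Longrightarrow> r \<le> q \<Longrightarrow> r = q"
  shows "q (- x) = - q x"
proof -
  define F where "F t y = q (y + t *\<^sub>R x) - t * q x" for t y
  define r where "r y = (INF t\<in>{0..}. F t y)" for y
  have lb: "- q (- y) \<le> F t y" if "t \<in> {0..}" for t y
    using sublinear_add[OF q, of "y + t *\<^sub>R x" "- y"] sublinear_scaleR[OF q, of t x] that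
    unfolding F_def by simp
  have bdd: "bdd_below ((\<lambda>t. F t y) ` {0..})" for y
    using lb by (intro bdd_belowI2[where m = "- q (- y)"])
  have "sublinear r"
    unfolding r_def
  proof (rule sublinear_INF[OF _ bdd])
    fix s t :: real and y z assume st: "s \<in> {0..}" "t \<in> {0..}"
    have "F (s + t) (y + z) \<le> F s y + F t z"
      using sublinear_add[OF q, of "y + s *\<^sub>R x" "z + t *\<^sub>R x"] unfolding F_def
      by (simp add: algebra_simps)
    with st show "\<exists>k\<in>{0..}. F k (y + z) \<le> F s y + F t z" by (intro bexI[of _ "s + t"]) auto
  next
    fix s t :: real and y assume st: "s \<in> {0..}" "t > 0"
    have "F (t * s) (t *\<^sub>R y) \<le> t * F s y"
      using sublinear_scaleR[OF q, of t "y + s *\<^sub>R x"] st unfolding F_def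
      by (simp add: algebra_simps)
    with st show "\<exists>k\<in>{0..}. F k (t *\<^sub>R y) \<le> t * F s y" by (intro bexI[of _ "t * s"]) auto
  qed auto
  moreover have "r \<le> q"
  proof (rule le_funI)
    fix y show "r y \<le> q y"
      unfolding r_def using cINF_lower[OF bdd, of 0 y] by (simp add: F_def)
  qed
  ultimately have "r = q" using min by blast
  then have "q (- x) \<le> F 1 (- x)"
    using cINF_lower[OF bdd, of 1 "- x"] by (simp add: r_def fun_eq_iff)
  then have "q (- x) \<le> - q x" using sublinear_0[OF q] by (simp add: F_def)
  with sublinear_minus[OF q, of x] show ?thesis by simp
qed

text \<open>Zorn's lemma for the reversed pointwise order gives a minimal sublinear functional below
  \<open>p\<close>; being odd, it is linear.\<close>

theorem hahn_banach_sublinear: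
  fixes p :: "'a::real_vector \<Rightarrow> real"
  assumes p: "sublinear p"
  obtains g where "linear g" "\<And>x. g x \<le> p x"
proof -
  define A where "A = {q. sublinear q \<and> q \<le> p}"
  have "\<exists>m\<in>A. \<forall>a\<in>A. m \<ge> a \<longrightarrow> a = m"
  proof (rule predicate_Zorn)
    show "partial_order_on A (relation_of (\<ge>) A)"
      by (rule partial_order_on_relation_ofI) auto
  next
    fix C assume C: "C \<in> Chains (relation_of (\<ge>) A)"
    then have CA: "C \<subseteq> A" and chain: "\<And>a b. a \<in> C \<Longrightarrow> b \<in> C \<Longrightarrow> a \<le> b \<or> b \<le> a"
      by (auto simp: Chains_def relation_of_def)
    show "\<exists>u\<in>A. \<forall>a\<in>C. a \<ge> u"
    proof (cases "C = {}")
      case True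
      then show ?thesis using p by (auto simp: A_def)
    next
      case False
      \<comment> \<open>This bound is the same for all members of the chain, so their pointwise
        infimum is finite.\<close>
      have lb: "- p (- y) \<le> q y" if "q \<in> C" for q y
        proof -
        have "sublinear q" "q (- y) \<le> p (- y)" using that CA by (auto simp: A_def le_fun_def)
        then show ?thesis using sublinear_minus[of q y] by simp
      qed
      have bdd: "bdd_below ((\<lambda>q. q y) ` C)" for y
        using lb by (intro bdd_belowI2[where m = "- p (- y)"])
      define u where "u y = (INF q\<in>C. q y)" for y
      have "sublinear u"
        unfolding u_def
      proof (rule sublinear_INF[OF False bdd])
        fix q r y z assume qr: "q \<in> C" "r \<in> C"
        then have "sublinear q" "sublinear r" using CA by (auto simp: A_def)
        then show "\<exists>k\<in>C. k (y + z) \<le> q y + r z"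
          using chain[OF qr] qr sublinear_add[of q y z] sublinear_add[of r y z]
          by (meson add_mono le_funD order_refl order_trans)
      next
        fix q t y assume "q \<in> C" "t > (0::real)"
        then show "\<exists>k\<in>C. k (t *\<^sub>R y) \<le> t * q y"
          using CA by (auto simp: A_def sublinear_def)
      qed
      moreover have uq: "u \<le> q" if "q \<in> C" for q
        using cINF_lower[OF bdd that] by (auto simp: u_def le_fun_def)
      moreover have "u \<le> p" using False uq CA by (fastforce simp: A_def)
      ultimately show ?thesis by (auto simp: A_def)
    qed
  qed
  then obtain q where q: "sublinear q" "q \<le> p" and min: "\<And>r. sublinear r \<Longrightarrow> r \<le> q \<Longrightarrow> r = q"
    unfolding A_def by (metis (mono_tags, lifting) mem_Collect_eq order_trans)
  note odd = minimal_sublinear_odd[OF q(1) min]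
  have "linear q"
  proof (rule linearI)
    fix x y
    have "q (- x + - y) \<le> q (- x) + q (- y)" by (rule sublinear_add[OF q(1)])
    then show "q (x + y) = q x + q y"
      using sublinear_add[OF q(1), of x y] odd[of x] odd[of y] odd[of "x + y"] by simp
  next
    fix t x
    show "q (t *\<^sub>R x) = t *\<^sub>R q x"
      using sublinear_scaleR[OF q(1), of t x] sublinear_scaleR[OF q(1), of "- t" x] odd[of "t *\<^sub>R x"]
      by (cases "t \<ge> 0") auto
  qed
  with q show thesis using that by (auto simp: le_fun_def)
qed

text \<open>
  \<open>g\<close> is dominated by the infimal convolution of \<open>\<phi> + \<epsilon> \<parallel>\<cdot>\<parallel>\<close> with the indicator of the
  cone spanned by the unit ball translated by \<open>- x\<close>, hence is close to \<open>\<phi>\<close> and attains its norm at \<open>x\<close>.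
\<close>

lemma state_near_almost_maximal:
  fixes \<phi> :: "'a::real_normed_vector \<Rightarrow>\<^sub>L real"
  assumes x: "norm x \<le> 1" and \<phi>: "norm \<phi> = 1" and \<epsilon>: "0 \<le> \<epsilon>" "\<epsilon> < 1"
    and max: "\<And>b. norm b \<le> 1 \<Longrightarrow> \<phi> b \<le> \<phi> x + \<epsilon> * norm (b - x)"
  obtains g where "norm x = 1" "g \<in> state_space x" "norm (g - \<phi>) \<le> 2 * \<epsilon>"
proof -
  \<comment> \<open>Almost maximality of \<open>x\<close> becomes
    \<open>\<phi> z \<le> \<epsilon> * norm z\<close> on this cone; \<open>s = 0\<close> contributes
    only \<open>0\<close>.\<close>
  define K where "K = {w - s *\<^sub>R x | s w. norm w \<le> s}"
  have Kadd: "z + z' \<in> K" if zz: "z \<in> K" "z' \<in> K" for z z'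
  proof -
    obtain s w s' w' where *: "z = w - s *\<^sub>R x" "norm w \<le> s" "z' = w' - s' *\<^sub>R x" "norm w' \<le> s'"
      using zz unfolding K_def by blast
    have "norm (w + w') \<le> s + s'" using *(2,4) norm_triangle_ineq[of w w'] by linarith
    moreover have "z + z' = (w + w') - (s + s') *\<^sub>R x" unfolding *(1,3) by (simp add: algebra_simps)
    ultimately show ?thesis unfolding K_def by blast
  qed
  have Kscale: "t *\<^sub>R z \<in> K" if zz: "z \<in> K" and t: "t > 0" for z t
  proof -
    obtain s w where *: "z = w - s *\<^sub>R x" "norm w \<le> s" using zz unfolding K_def by blast
    have "norm (t *\<^sub>R w) \<le> t * s" using * t by simp
    moreover have "t *\<^sub>R z = t *\<^sub>R w - (t * s) *\<^sub>R x" unfolding *(1) by (simp add: algebra_simps)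
    ultimately show ?thesis unfolding K_def by blast
  qed
  have K\<phi>: "\<phi> z \<le> \<epsilon> * norm z" if zz: "z \<in> K" for z
  proof -
    obtain s w where *: "z = w - s *\<^sub>R x" "norm w \<le> s" using zz unfolding K_def by blast
    show ?thesis
    proof (cases "s = 0")
      case True
      then show ?thesis using * \<epsilon> by (simp add: blinfun.zero_right)
    next
      case False
      then have s: "s > 0" using * norm_ge_zero[of w] by linarith
      define b where "b = w /\<^sub>R s"
      have z: "z = s *\<^sub>R (b - x)" using s * by (simp add: b_def algebra_simps)
      have "norm b \<le> 1" using s * by (simp add: b_def field_simps)
      from max[OF this] have "\<phi> (b - x) \<le> \<epsilon> * norm (b - x)" by (simp add: blinfun.diff_right)
      then have "s * \<phi> (b - x) \<le> s * (\<epsilon> * norm (b - x))" using s by simp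
      then show ?thesis unfolding z using s by (simp add: blinfun.scaleR_right mult.left_commute)
    qed
  qed
  have K0: "0 \<in> K" unfolding K_def by (auto intro!: exI[of _ 0])
  define F where "F z y = \<phi> (y - z) + \<epsilon> * norm (y - z)" for z y
  have lb: "\<phi> y - \<epsilon> * norm y \<le> F z y" if "z \<in> K" for z y
  proof -
    have "\<epsilon> * norm z \<le> \<epsilon> * (norm (y - z) + norm y)"
      using \<epsilon>(1) by (intro mult_left_mono) (metis norm_minus_commute norm_triangle_sub add.commute, simp)
    then show ?thesis using K\<phi>[OF that] by (simp add: F_def blinfun.diff_right algebra_simps)
  qed
  have bdd: "bdd_below ((\<lambda>z. F z y) ` K)" for y
    using lb by (intro bdd_belowI2[where m = "\<phi> y - \<epsilon> * norm y"])
  have "sublinear (\<lambda>y. INF z\<in>K. F z y)"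
  proof (rule sublinear_INF[OF _ bdd])
    show "K \<noteq> {}" using K0 by auto
  next
    fix i j y z assume ij: "i \<in> K" "j \<in> K"
    have eq: "y + z - (i + j) = (y - i) + (z - j)" by (simp add: algebra_simps)
    have "\<epsilon> * norm (y + z - (i + j)) \<le> \<epsilon> * (norm (y - i) + norm (z - j))"
      unfolding eq using \<epsilon>(1) by (intro mult_left_mono norm_triangle_ineq)
    then have "F (i + j) (y + z) \<le> F i y + F j z"
      unfolding F_def by (simp add: blinfun.bilinear_simps algebra_simps)
    with ij show "\<exists>k\<in>K. F k (y + z) \<le> F i y + F j z" using Kadd by blast
  next
    fix i y and t :: real assume i: "i \<in> K" and t: "t > 0"
    have eq: "t *\<^sub>R y - t *\<^sub>R i = t *\<^sub>R (y - i)" by (simp add: algebra_simps)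
    have "F (t *\<^sub>R i) (t *\<^sub>R y) \<le> t * F i y"
      unfolding F_def eq using t by (simp add: blinfun.scaleR_right distrib_left)
    with i t show "\<exists>k\<in>K. F k (t *\<^sub>R y) \<le> t * F i y" using Kscale by blast
  qed
  then obtain G where G: "linear G" and GP: "\<And>y. G y \<le> (INF z\<in>K. F z y)"
    by (rule hahn_banach_sublinear) blast
  have GF: "G y \<le> F z y" if "z \<in> K" for y z
    using GP[of y] cINF_lower[OF bdd that, of y] by linarith
  \<comment> \<open>The index \<open>z = 0\<close> bounds \<open>G - \<phi>\<close> by
    \<open>\<epsilon>\<close> times the norm; the index \<open>z = y\<close> will make
    \<open>G\<close> nonpositive on \<open>K\<close>.\<close>
  have G1: "G y - \<phi> y \<le> \<epsilon> * norm y" for y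
    using GF[OF K0, of y] by (simp add: F_def)
  have Gabs: "\<bar>G y - \<phi> y\<bar> \<le> \<epsilon> * norm y" for y
    using G1[of y] G1[of "- y"] linear_neg[OF G, of y] by (simp add: blinfun.minus_right abs_le_iff)
  have "bounded_linear G"
  proof (intro bounded_linear.intro G bounded_linear_axioms.intro exI allI)
    fix y
    have "\<bar>\<phi> y\<bar> \<le> norm y" using norm_blinfun[of \<phi> y] \<phi> by simp
    then show "norm (G y) \<le> norm y * (1 + \<epsilon>)" using Gabs[of y] by (simp add: algebra_simps)
  qed
  then obtain g where g: "\<And>y. blinfun_apply g y = G y" by (metis bounded_linear_Blinfun_apply)
  have g\<phi>: "norm (g - \<phi>) \<le> \<epsilon>"
    by (rule norm_blinfun_bound[OF \<epsilon>(1)]) (simp add: blinfun.diff_left g Gabs)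
  then have "norm g \<ge> 1 - \<epsilon>" using \<phi> norm_triangle_ineq2[of \<phi> g] by (simp add: norm_minus_commute)
  then have gpos: "norm g > 0" using \<epsilon> by linarith
  have gx: "g b \<le> g x * norm b" for b
  proof (cases "b = 0")
    case False
    have "b - norm b *\<^sub>R x \<in> K" unfolding K_def by auto
    then have "G (b - norm b *\<^sub>R x) \<le> 0" using GF[of "b - norm b *\<^sub>R x" "b - norm b *\<^sub>R x"]
      by (simp add: F_def blinfun.zero_right)
    then show ?thesis using linear_diff[OF G] linear_scale[OF G] by (simp add: g mult.commute)
  qed (simp add: blinfun.zero_right)
  have gx0: "g x \<ge> 0"
  proof -
    have "g b \<noteq> 0 \<Longrightarrow> ?thesis" for b
      using gx[of b] gx[of "- b"] by (simp add: blinfun.minus_right)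
        (smt (verit) mult_nonneg_nonneg mult_nonpos_nonneg norm_ge_zero)
    moreover have "\<exists>b. g b \<noteq> 0" using gpos by (metis blinfun_eqI norm_zero zero_blinfun.rep_eq less_irrefl)
    ultimately show ?thesis by blast
  qed
  have "norm g \<le> g x"
  proof (rule norm_blinfun_bound[OF gx0])
    fix b show "norm (g b) \<le> g x * norm b"
      using gx[of b] gx[of "- b"] by (simp add: blinfun.minus_right abs_le_iff)
  qed
  moreover have "g x \<le> norm g * norm x" using norm_blinfun[of g x] by simp
  moreover have "norm g * norm x \<le> norm g" using x gpos by (simp add: mult_left_le)
  ultimately have "norm g = g x" "norm g * norm x = norm g" by linarith+
  then have ngx: "norm g = g x" "norm x = 1" using gpos by auto
  \<comment> \<open>Normalising moves \<open>g\<close> by \<open>\<bar>1 - norm g\<bar>\<close>,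
    again at most \<open>\<epsilon>\<close>; hence the factor 2.\<close>
  define h where "h = g /\<^sub>R norm g"
  have "h \<in> state_space x"
    using gpos ngx by (auto simp: state_space_def h_def blinfun.scaleR_left)
  moreover have "norm (h - \<phi>) \<le> 2 * \<epsilon>"
  proof -
    have "h - g = (1 / norm g - 1) *\<^sub>R g" by (simp add: h_def algebra_simps divide_inverse)
    then have "norm (h - g) = \<bar>1 / norm g - 1\<bar> * norm g" by simp
    also have "\<dots> = \<bar>(1 / norm g - 1) * norm g\<bar>" by (simp add: abs_mult)
    also have "\<dots> = \<bar>1 - norm g\<bar>" using gpos by (simp add: left_diff_distrib)
    also have "\<dots> \<le> norm (g - \<phi>)"
      using norm_triangle_ineq3[of g \<phi>] \<phi> by simp
    finally show ?thesis using g\<phi> norm_triangle_ineq[of "h - g" "g - \<phi>"] by simp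
  qed
  ultimately show thesis using that ngx(2) by blast
qed

section \<open>Consequences of strong subdifferentiability\<close>

text \<open>Ekeland's variational principle for a linear functional on the unit ball.\<close>

lemma almost_maximal_in_ball:
  fixes \<phi> :: "'a::banach \<Rightarrow>\<^sub>L real"
  assumes \<epsilon>: "\<epsilon> > 0"
  obtains x where "norm x \<le> 1" "\<And>b. norm b \<le> 1 \<Longrightarrow> \<phi> b \<le> \<phi> x + \<epsilon> * norm (b - x)"
proof -
  \<comment> \<open>This is Ekeland's order: \<open>\<phi>\<close> grows from \<open>a\<close> to
    \<open>b\<close> at slope at least \<open>\<epsilon>\<close>. A maximal point for it is the one
    sought.\<close>
  define S where "S a = {b. norm b \<le> 1 \<and> \<epsilon> * norm (b - a) \<le> \<phi> b - \<phi> a}" for a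
  have Strans: "c \<in> S a" if "b \<in> S a" "c \<in> S b" for a b c
  proof -
    have "\<epsilon> * norm (c - a) \<le> \<epsilon> * (norm (c - b) + norm (b - a))"
      using \<epsilon> norm_triangle_ineq[of "c - b" "b - a"] by simp
    with that show ?thesis by (simp add: S_def algebra_simps)
  qed
  have \<phi>le: "\<phi> b \<le> norm \<phi>" if "norm b \<le> 1" for b
  proof -
    have "\<phi> b \<le> norm \<phi> * norm b" using norm_blinfun[of \<phi> b] by simp
    also have "\<dots> \<le> norm \<phi>" using that by (simp add: mult_left_le)
    finally show ?thesis .
  qed
  have bdd: "bdd_above (\<phi> ` S a)" for a
    using \<phi>le by (intro bdd_aboveI2[where M = "norm \<phi>"]) (simp add: S_def)
  \<comment> \<open>The point \<open>a'\<close> achieves at least half of the gain in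
    \<open>\<phi>\<close> available on \<open>S a\<close>, in place of a maximum that may not be
    attained.\<close>
  have step: "\<exists>a'. norm a' \<le> 1 \<and> a' \<in> S a \<and> (\<forall>b\<in>S a. \<phi> b \<le> 2 * \<phi> a' - \<phi> a)" if "norm a \<le> 1" for a
  proof -
    have aS: "a \<in> S a" using that by (simp add: S_def)
    define s where "s = (SUP b\<in>S a. \<phi> b)"
    have s: "\<phi> b \<le> s" if "b \<in> S a" for b unfolding s_def using bdd that by (rule cSUP_upper2) simp
    show ?thesis
    proof (cases "s \<le> \<phi> a")
      case True
      then show ?thesis using aS that s by (intro exI[of _ a]) force
    next
      case False
      then have "(s + \<phi> a) / 2 < s" by simp
      then obtain a' where "a' \<in> S a" "(s + \<phi> a) / 2 < \<phi> a'"
        unfolding s_def using less_cSUP_iff[OF _ bdd] aS by blast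
      moreover from this have "norm a' \<le> 1" by (simp add: S_def)
      ultimately show ?thesis using s by (intro exI[of _ a']) force
    qed
  qed
  have "\<exists>x. \<forall>n. norm (x n) \<le> 1 \<and> x (Suc n) \<in> S (x n) \<and> (\<forall>b\<in>S (x n). \<phi> b \<le> 2 * \<phi> (x (Suc n)) - \<phi> (x n))"
    using dependent_nat_choice[of "\<lambda>n a. norm a \<le> 1" "\<lambda>n a a'. a' \<in> S a \<and> (\<forall>b\<in>S a. \<phi> b \<le> 2 * \<phi> a' - \<phi> a)"]
      step by (metis norm_zero zero_le_one)
  then obtain x where x: "\<And>n. norm (x n) \<le> 1" "\<And>n. x (Suc n) \<in> S (x n)"
    "\<And>n b. b \<in> S (x n) \<Longrightarrow> \<phi> b \<le> 2 * \<phi> (x (Suc n)) - \<phi> (x n)" by blast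
  have xS: "x m \<in> S (x n)" if "n \<le> m" for m n
    using that
  proof (induction rule: dec_induct)
    case base
    then show ?case using x(1)[of n] by (simp add: S_def)
  next
    case (step k)
    then show ?case using x(2) Strans by blast
  qed
  have "incseq (\<lambda>n. \<phi> (x n))"
  proof (rule incseq_SucI)
    fix n
    have "0 \<le> \<epsilon> * norm (x (Suc n) - x n)" using \<epsilon> by simp
    then show "\<phi> (x n) \<le> \<phi> (x (Suc n))" using x(2)[of n] by (simp add: S_def)
  qed
  moreover have "\<phi> (x n) \<le> norm \<phi>" for n using \<phi>le x(1) by blast
  ultimately obtain L where L: "(\<lambda>n. \<phi> (x n)) \<longlonglongrightarrow> L" by (metis incseq_convergent)
  have "Cauchy x"
  proof (rule metric_CauchyI)
    fix e :: real assume e: "e > 0"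
    then have "\<epsilon> * e > 0" using \<epsilon> by simp
    then obtain N where N: "\<And>m n. m \<ge> N \<Longrightarrow> n \<ge> N \<Longrightarrow> dist (\<phi> (x m)) (\<phi> (x n)) < \<epsilon> * e"
      using metric_CauchyD[OF LIMSEQ_imp_Cauchy[OF L]] by metis
    have *: "dist (x m) (x n) < e" if "N \<le> n" "n \<le> m" for m n
    proof -
      have "\<epsilon> * norm (x m - x n) \<le> \<phi> (x m) - \<phi> (x n)" using xS[OF that(2)] by (simp add: S_def)
      also have "\<dots> < \<epsilon> * e" using N[of m n] that by (simp add: dist_real_def)
      finally show ?thesis using \<epsilon> by (simp add: dist_norm)
    qed
    have "dist (x m) (x n) < e" if "N \<le> m" "N \<le> n" for m n
      using *[of n m] *[of m n] that by (metis dist_commute linear)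
    then show "\<exists>M. \<forall>m\<ge>M. \<forall>n\<ge>M. dist (x m) (x n) < e" by blast
  qed
  then obtain y where y: "x \<longlonglongrightarrow> y" using Cauchy_convergent convergent_def by blast
  have \<phi>y: "(\<lambda>n. \<phi> (x n)) \<longlonglongrightarrow> \<phi> y" using y by (intro tendsto_intros)
  have ySn: "y \<in> S (x n)" for n
  proof -
    have "closed (S (x n))"
      unfolding S_def by (intro closed_Collect_conj closed_Collect_le continuous_intros)
    then show ?thesis using xS
      by (intro Lim_in_closed_set[OF _ _ _ y]) (auto intro: eventually_sequentiallyI)
  qed
  \<comment> \<open>Such a \<open>b\<close> lies in all \<open>S (x n)\<close>, and the upper bounds
    chosen there converge to \<open>\<phi> y\<close>.\<close>
  have "\<phi> b \<le> \<phi> y" if b: "b \<in> S y" for b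
  proof (rule LIMSEQ_le_const)
    have "(\<lambda>n. 2 * \<phi> (x (Suc n)) - \<phi> (x n)) \<longlonglongrightarrow> 2 * \<phi> y - \<phi> y"
      by (intro tendsto_diff tendsto_mult_left \<phi>y LIMSEQ_Suc[OF \<phi>y])
    then show "(\<lambda>n. 2 * \<phi> (x (Suc n)) - \<phi> (x n)) \<longlonglongrightarrow> \<phi> y" by simp
    show "\<exists>N. \<forall>n\<ge>N. \<phi> b \<le> 2 * \<phi> (x (Suc n)) - \<phi> (x n)"
      using x(3) Strans[OF ySn b] by blast
  qed
  then have "\<phi> b \<le> \<phi> y + \<epsilon> * norm (b - y)" if "norm b \<le> 1" for b
    using that \<epsilon> by (cases "b \<in> S y") (fastforce simp: S_def intro: add_increasing2)+
  moreover have "norm y \<le> 1" using ySn by (simp add: S_def)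
  ultimately show thesis using that by blast
qed

text \<open>Ekeland's principle supplies an almost maximal \<open>x\<close> with slope
  \<open>e\<close>, and some state of \<open>x\<close> lies within \<open>2 * e\<close> of
  \<open>\<phi>\<close>. The cap at \<open>1 / 2\<close> keeps the slope below 1, as
  \<open>state_near_almost_maximal\<close> requires.\<close>

theorem bishop_phelps:
  fixes \<phi> :: "'a::banach \<Rightarrow>\<^sub>L real"
  assumes "norm \<phi> = 1" "\<epsilon> > 0"
  obtains x g where "norm x = 1" "g \<in> state_space x" "norm (g - \<phi>) \<le> \<epsilon>"
proof -
  define e where "e = min (\<epsilon> / 2) (1 / 2)"
  have e: "0 < e" "e < 1" "2 * e \<le> \<epsilon>" using assms by (auto simp: e_def)
  obtain x where x: "norm x \<le> 1" "\<And>b. norm b \<le> 1 \<Longrightarrow> \<phi> b \<le> \<phi> x + e * norm (b - x)"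
    using almost_maximal_in_ball[OF e(1)] by blast
  show thesis
    using state_near_almost_maximal[OF x(1) assms(1) _ e(2) x(2)] that e by (metis order_trans less_imp_le)
qed

text \<open>Uniformity of the limit gives one step \<open>t0\<close> serving all directions. A
  functional almost norming \<open>x\<close> then has slope at most \<open>e\<close> from
  \<open>x\<close> towards every point of the ball, so a state of \<open>x\<close> is close to
  it.\<close>

lemma ssd_at_strongly_exposed:
  fixes x :: "'a::real_normed_vector"
  assumes ssd: "ssd_at x" and x: "norm x = 1" and \<epsilon>: "\<epsilon> > 0"
  obtains \<delta> where "\<delta> > 0"
    "\<And>\<phi>. norm \<phi> = 1 \<Longrightarrow> blinfun_apply \<phi> x > 1 - \<delta> \<Longrightarrow> \<exists>g\<in>state_space x. norm (g - \<phi>) \<le> \<epsilon>"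
proof -
  define e where "e = min (\<epsilon> / 2) (1 / 2)"
  have e: "0 < e" "e < 1" "2 * e \<le> \<epsilon>" using \<epsilon> by (auto simp: e_def)
  define D where "D t y = (norm (x + t *\<^sub>R y) - norm x) / t" for t y
  obtain l where "uniform_limit (cball 0 1) D l (at_right 0)"
    using ssd unfolding ssd_at_def D_def by blast
  then have "\<forall>\<^sub>F t in at_right 0. \<forall>y\<in>cball 0 1. dist (D t y) (l y) < e / 4"
    using e by (intro uniform_limitD) auto
  then obtain b where b: "b > 0" "\<And>t y. 0 < t \<Longrightarrow> t < b \<Longrightarrow> norm y \<le> 1 \<Longrightarrow> \<bar>D t y - l y\<bar> < e / 4"
    unfolding eventually_at_right_field by (auto simp: dist_real_def)
  define t0 where "t0 = b / 2"
  have t0: "t0 > 0" "t0 < b" using b by (auto simp: t0_def)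
  show thesis
  proof (rule that[of "e * t0 / 2"])
    show "e * t0 / 2 > 0" using e t0 by simp
    fix \<phi> :: "'a \<Rightarrow>\<^sub>L real" assume \<phi>: "norm \<phi> = 1" "\<phi> x > 1 - e * t0 / 2"
    have "\<phi> c \<le> \<phi> x + e * norm (c - x)" if c: "norm c \<le> 1" for c
    proof (cases "c = x")
      case False
      define r where "r = norm (c - x)"
      have r: "r > 0" using False by (simp add: r_def)
      define u where "u = (c - x) /\<^sub>R r"
      have u: "norm u = 1" "c = x + r *\<^sub>R u" using r by (auto simp: u_def r_def)
      have Dr: "D r u \<le> 0" using r u c x by (simp add: D_def field_simps)
      \<comment> \<open>For \<open>r \<le> t0\<close> the quotients at \<open>r\<close> and
        \<open>t0\<close> are both within \<open>e / 4\<close> of \<open>l u\<close>. For larger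
        \<open>r\<close> the point \<open>x + t0 u\<close> lies on the segment from \<open>x\<close>
        to \<open>c\<close>, hence in the ball.\<close>
      have "D t0 u \<le> e / 2"
      proof (cases "r \<le> t0")
        case True
        then have "\<bar>D r u - l u\<bar> < e / 4" "\<bar>D t0 u - l u\<bar> < e / 4"
          using b(2) t0 r u by auto
        then show ?thesis using Dr unfolding abs_less_iff by linarith
      next
        case False
        then have s: "0 < t0 / r" "t0 / r < 1" using t0 r by auto
        have "x + t0 *\<^sub>R u = (1 - t0 / r) *\<^sub>R x + (t0 / r) *\<^sub>R c"
          using r unfolding u(2) by (simp add: algebra_simps)
        then have "norm (x + t0 *\<^sub>R u) \<le> (1 - t0 / r) * norm x + (t0 / r) * norm c"
          using s t0 r norm_triangle_ineq[of "(1 - t0 / r) *\<^sub>R x" "(t0 / r) *\<^sub>R c"] by simp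
        also have "\<dots> \<le> (1 - t0 / r) * 1 + (t0 / r) * 1"
          using s c x by (intro add_mono mult_left_mono) auto
        finally have "D t0 u \<le> 0" using t0 x by (simp add: D_def field_simps)
        then show ?thesis using e by simp
      qed
      then have "norm (x + t0 *\<^sub>R u) - 1 \<le> e / 2 * t0" using t0 x by (simp add: D_def field_simps)
      moreover have "\<phi> (x + t0 *\<^sub>R u) \<le> norm (x + t0 *\<^sub>R u)"
        using norm_blinfun[of \<phi> "x + t0 *\<^sub>R u"] \<phi> by simp
      ultimately have "t0 * \<phi> u \<le> t0 * e" using \<phi>(2) by (simp add: blinfun.bilinear_simps algebra_simps)
      then have "\<phi> u \<le> e" using t0 by simp
      then have "r * \<phi> u \<le> r * e" using r by simp
      then show ?thesis unfolding u(2) using r u(1) by (simp add: blinfun.bilinear_simps mult.commute)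
    qed simp
    then obtain g where "g \<in> state_space x" "norm (g - \<phi>) \<le> 2 * e"
      using state_near_almost_maximal[of x \<phi> e] x \<phi> e by (metis less_imp_le order_refl)
    then show "\<exists>g\<in>state_space x. norm (g - \<phi>) \<le> \<epsilon>" using e by (metis order_trans)
  qed
qed

text \<open>Neither \<open>h\<close> nor \<open>g - h\<close> can exceed its norm at
  \<open>x\<close>, but their values there add up to the sum of their norms.\<close>

lemma part_attains:
  fixes g h :: "'a::real_normed_vector \<Rightarrow>\<^sub>L real"
  assumes "norm x \<le> 1" "g x = norm g" "norm g = norm h + norm (g - h)"
  shows "h x = norm h" and "(g - h) x = norm (g - h)"
proof -
  have "k x \<le> norm k" for k :: "'a \<Rightarrow>\<^sub>L real"
    using norm_blinfun[of k x] assms(1) mult_left_le[of "norm x" "norm k"] by simp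
  from this[of h] this[of "g - h"] assms
  show "h x = norm h" "(g - h) x = norm (g - h)" by (auto simp: blinfun.diff_left)
qed

text \<open>
  \<open>h\<close> is the median of \<open>0\<close>, \<open>f\<close> and \<open>g\<close>: every \<open>L\<^sup>1\<close>-space has this property, with the pointwise
  median.
\<close>

definition norm_medians :: "'b::real_normed_vector itself \<Rightarrow> bool" where
  "norm_medians _ \<longleftrightarrow> (\<forall>f g::'b. \<exists>h. norm f = norm h + norm (f - h) \<and>
     norm g = norm h + norm (g - h) \<and> norm (f - g) = norm (f - h) + norm (g - h))"

text \<open>
  If \<open>y\<close> is near \<open>x\<close>, then \<open>f \<in> state_space y\<close> has distance at most \<open>1\<close> from \<open>state_space x\<close>. So
  \<open>f\<close> splits into a part \<open>h\<close> attained at \<open>x\<close> and a part of norm at most \<open>1/2\<close> which is again a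
  multiple of a state of \<open>y\<close>: the maximal defect \<open>c\<close> of these states at \<open>x\<close> satisfies
  \<open>c \<le> c / 2\<close>.
\<close>

lemma norm_medians_imp_quasi_polyhedral:
  assumes med: "norm_medians TYPE('a::real_normed_vector \<Rightarrow>\<^sub>L real)"
    and ssd: "\<And>x::'a. norm x = 1 \<Longrightarrow> ssd_at x"
  shows "quasi_polyhedral TYPE('a)"
  unfolding quasi_polyhedral_def
proof (intro allI impI)
  fix x :: 'a assume x: "norm x = 1"
  obtain \<delta> where \<delta>: "\<delta> > 0" "\<And>\<phi>. norm \<phi> = 1 \<Longrightarrow> blinfun_apply \<phi> x > 1 - \<delta> \<Longrightarrow> \<exists>g\<in>state_space x. norm (g - \<phi>) \<le> 1"
    using ssd_at_strongly_exposed[OF ssd[OF x] x, of 1] by auto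
  have "state_space y \<subseteq> state_space x" if y: "norm y = 1" "norm (y - x) < \<delta>" for y
  proof
    fix f0 assume f0: "f0 \<in> state_space y"
    have le1: "blinfun_apply f x \<le> 1 \<and> - 1 \<le> blinfun_apply f x" if "f \<in> state_space y" for f
      using norm_blinfun[of f x] that x by (auto simp: state_space_def abs_le_iff)
    define c where "c = (SUP f\<in>state_space y. 1 - blinfun_apply f x)"
    have bdd: "bdd_above ((\<lambda>f. 1 - blinfun_apply f x) ` state_space y)"
      using le1 by (intro bdd_aboveI2[where M = 2]) force
    have c: "1 - f x \<le> c" if "f \<in> state_space y" for f
      unfolding c_def using bdd that by (rule cSUP_upper2) simp
    have c0: "0 \<le> c" using c[OF f0] le1[OF f0] by linarith
    have half: "1 - f x \<le> c / 2" if f: "f \<in> state_space y" for f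
    proof -
      have nf: "norm f = 1" "f y = 1" using f by (auto simp: state_space_def)
      have "f y - f x \<le> norm (y - x)"
        using norm_blinfun[of f "y - x"] nf by (simp add: blinfun.diff_right)
      then have "f x > 1 - \<delta>" using nf y by simp
      then obtain g where g: "g \<in> state_space x" "norm (g - f) \<le> 1" using \<delta>(2) nf by blast
      then have ng: "norm g = 1" "g x = 1" by (auto simp: state_space_def)
      obtain h where h: "norm f = norm h + norm (f - h)" "norm g = norm h + norm (g - h)"
        "norm (f - g) = norm (f - h) + norm (g - h)"
        using med unfolding norm_medians_def by blast
      have hx: "h x = norm h" using part_attains(1)[OF _ _ h(2)] x ng by simp
      have fhy: "(f - h) y = norm (f - h)" using part_attains(2)[OF _ _ h(1)] y nf by simp
      \<comment> \<open>Both \<open>f\<close> and \<open>g\<close> have norm 1, so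
        \<open>f - h\<close> and \<open>g - h\<close> have equal norms, and these sum to at most
        1.\<close>
      have le: "norm (f - h) \<le> 1 / 2" using h g(2) nf ng by (simp add: norm_minus_commute)
      have fx: "1 - f x = norm (f - h) - (f - h) x" using hx h(1) nf by (simp add: blinfun.diff_left)
      show ?thesis
      proof (cases "f - h = 0")
        case True
        then show ?thesis using fx c0 by (simp add: blinfun.zero_left)
      next
        case False
        define k where "k = (f - h) /\<^sub>R norm (f - h)"
        have "k \<in> state_space y"
          using False fhy by (simp add: state_space_def k_def blinfun.scaleR_left)
        then have "norm (f - h) * (1 - k x) \<le> 1 / 2 * c"
          using c[of k] le1[of k] le c0 by (intro mult_mono) auto
        moreover have "norm (f - h) * (1 - k x) = 1 - f x"
          unfolding fx k_def blinfun.scaleR_left using False by (simp add: right_diff_distrib)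
        ultimately show ?thesis by simp
      qed
    qed
    have "c \<le> c / 2" unfolding c_def using half f0 by (intro cSUP_least) (auto simp: c_def)
    then have "f0 x = 1" using c0 c[OF f0] le1[OF f0] by simp
    then show "f0 \<in> state_space x" using f0 by (simp add: state_space_def)
  qed
  then show "\<exists>\<delta>>0. \<forall>y. norm y = 1 \<and> norm (y - x) < \<delta> \<longrightarrow> state_space y \<subseteq> state_space x"
    using \<delta>(1) by blast
qed

section \<open>Exclusion of atomless parts\<close>

locale L1_isometry =
  fixes M :: "'m measure" and T :: "('m \<Rightarrow> real) \<Rightarrow> 'b::real_normed_vector"
  assumes T_add: "integrable M f \<Longrightarrow> integrable M g \<Longrightarrow> T (\<lambda>s. f s + g s) = T f + T g"
    and T_scale: "integrable M f \<Longrightarrow> T (\<lambda>s. c * f s) = c *\<^sub>R T f"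
    and norm_T: "integrable M f \<Longrightarrow> norm (T f) = (LINT s|M. \<bar>f s\<bar>)"
    and surj_T: "\<exists>f. integrable M f \<and> T f = b"
begin

lemma T_diff: "integrable M f \<Longrightarrow> integrable M g \<Longrightarrow> T (\<lambda>s. f s - g s) = T f - T g"
  using T_add[of f "\<lambda>s. - 1 * g s"] T_scale[of g "- 1"] by simp

lemma T_sum:
  assumes "finite I" "\<And>i. i \<in> I \<Longrightarrow> integrable M (f i)"
  shows "T (\<lambda>s. \<Sum>i\<in>I. f i s) = (\<Sum>i\<in>I. T (f i))"
  using assms
proof (induction I)
  case empty
  show ?case using T_scale[of "\<lambda>s. 0" 0] by simp
qed (simp add: T_add)

lemma norm_T_nonneg:
  "integrable M f \<Longrightarrow> (\<And>s. 0 \<le> f s) \<Longrightarrow> norm (T f) = (LINT s|M. f s)"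
  by (simp add: norm_T)

lemma norm_medians: "norm_medians TYPE('b)"
  unfolding norm_medians_def
proof (intro allI)
  fix a b :: 'b
  obtain f g where f: "integrable M f" "T f = a" and g: "integrable M g" "T g = b"
    using surj_T by metis
  \<comment> \<open>The median, written as the common part of the positive parts minus that of the
    negative parts.\<close>
  define h where "h s = min (max (f s) 0) (max (g s) 0) - min (max (- f s) 0) (max (- g s) 0)" for s
  have h: "integrable M h" unfolding h_def using f g by auto
  have *: "norm (T u) = norm (T v) + norm (T w)"
    if "\<And>s. \<bar>u s\<bar> = \<bar>v s\<bar> + \<bar>w s\<bar>" "integrable M u" "integrable M v" "integrable M w" for u v w
    using that by (simp add: norm_T)
  have median: "\<bar>f s\<bar> = \<bar>h s\<bar> + \<bar>f s - h s\<bar>" "\<bar>g s\<bar> = \<bar>h s\<bar> + \<bar>g s - h s\<bar>"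
    "\<bar>f s - g s\<bar> = \<bar>f s - h s\<bar> + \<bar>g s - h s\<bar>" for s
    unfolding h_def
    by (cases "0 \<le> f s"; cases "0 \<le> g s"; cases "f s \<le> g s"; simp add: max_def min_def)+
  have norms: "norm (T f) = norm (T h) + norm (T (\<lambda>s. f s - h s))"
    "norm (T g) = norm (T h) + norm (T (\<lambda>s. g s - h s))"
    "norm (T (\<lambda>s. f s - g s)) = norm (T (\<lambda>s. f s - h s)) + norm (T (\<lambda>s. g s - h s))"
    using f g h median by (intro *; simp)+
  show "\<exists>h. norm a = norm h + norm (a - h) \<and> norm b = norm h + norm (b - h) \<and>
      norm (a - b) = norm (a - h) + norm (b - h)"
    using f g h norms by (intro exI[of _ "T h"]) (simp add: T_diff)
qed

end

section \<open>Functions peaking on a set of vectors\<close>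

locale L1_dual = L1_isometry M T for M :: "'m measure" and T :: "('m \<Rightarrow> real) \<Rightarrow> ('a::banach \<Rightarrow>\<^sub>L real)"
begin

text \<open>The integral of a nonnegative \<open>u\<close> is \<open>norm (T u)\<close>. So for
  \<open>F\<close> in the unit ball these are the \<open>u\<close> whose functional attains its norm
  at each point of \<open>F\<close>.\<close>

definition peak :: "'a set \<Rightarrow> ('m \<Rightarrow> real) set" where
  "peak F = {u. integrable M u \<and> (\<forall>s. 0 \<le> u s) \<and> (\<forall>x\<in>F. blinfun_apply (T u) x = (LINT s|M. u s))}"

lemma peakD:
  assumes "u \<in> peak F"
  shows "integrable M u" "0 \<le> u s" "x \<in> F \<Longrightarrow> blinfun_apply (T u) x = (LINT s|M. u s)"
  using assms by (auto simp: peak_def)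

lemma peak_insert: "u \<in> peak (insert x F) \<longleftrightarrow> u \<in> peak {x} \<and> u \<in> peak F"
  by (auto simp: peak_def)

text \<open>The norm is additive on the images of \<open>v\<close> and \<open>u - v\<close>, so
  \<open>part_attains\<close> applies at each point of \<open>F\<close>.\<close>

lemma peak_le:
  assumes F: "F \<subseteq> cball 0 1" and u: "u \<in> peak F"
    and v: "integrable M v" "\<And>s. 0 \<le> v s" "\<And>s. v s \<le> u s"
  shows "v \<in> peak F"
proof -
  note u' = peakD[OF u]
  have "norm (T u - T v) = (LINT s|M. u s - v s)"
    using norm_T_nonneg[of "\<lambda>s. u s - v s"] u' v by (simp add: T_diff)
  then have "norm (T u) = norm (T v) + norm (T u - T v)"
    using u' v by (simp add: norm_T_nonneg)
  then have "blinfun_apply (T v) x = norm (T v)" if "x \<in> F" for x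
    using that part_attains(1)[of x "T u" "T v"] u' F by (auto simp: norm_T_nonneg)
  then show ?thesis using v by (auto simp: peak_def norm_T_nonneg)
qed

lemma peak_scale: "u \<in> peak F \<Longrightarrow> 0 \<le> c \<Longrightarrow> (\<lambda>s. c * u s) \<in> peak F"
  by (auto simp: peak_def T_scale blinfun.scaleR_left)

text \<open>The maximum lies below the sum, which peaks by linearity.\<close>

lemma peak_max:
  assumes F: "F \<subseteq> cball 0 1" and u: "u \<in> peak F" "v \<in> peak F"
  shows "(\<lambda>s. max (u s) (v s)) \<in> peak F"
proof (rule peak_le[OF F])
  show "(\<lambda>s. u s + v s) \<in> peak F"
    using u by (auto simp: peak_def T_add blinfun.add_left)
qed (use peakD[OF u(1)] peakD[OF u(2)] in \<open>auto simp: le_max_iff_disj\<close>)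

text \<open>The two parts split \<open>T w\<close> norm-additively; the negative part enters with a
  minus sign and therefore peaks at \<open>- x\<close>.\<close>

lemma pos_part_peak:
  assumes w: "integrable M w" and x: "norm x \<le> 1" and eq: "blinfun_apply (T w) x = norm (T w)"
  shows "(\<lambda>s. max (w s) 0) \<in> peak {x}" "(\<lambda>s. max (- w s) 0) \<in> peak {- x}"
proof -
  define p n where "p s = max (w s) 0" and "n s = max (- w s) 0" for s
  have pn: "integrable M p" "integrable M n" "\<And>s. 0 \<le> p s" "\<And>s. 0 \<le> n s"
    unfolding p_def n_def using w by auto
  have w_eq: "w = (\<lambda>s. p s - n s)" by (auto simp: p_def n_def)
  have Tw: "T w = T p - T n" unfolding w_eq using pn by (intro T_diff)
  have "norm (T w) = (LINT s|M. p s + n s)"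
    unfolding norm_T[OF w] by (intro Bochner_Integration.integral_cong) (auto simp: p_def n_def)
  also have "\<dots> = norm (T p) + norm (T n)" using pn by (simp add: norm_T_nonneg)
  finally have *: "norm (T w) = norm (T p) + norm (T w - T p)" by (simp add: Tw)
  have "blinfun_apply (T p) x = norm (T p)" "blinfun_apply (T w - T p) x = norm (T w - T p)"
    using part_attains[OF x eq *] by auto
  then have "p \<in> peak {x}" "n \<in> peak {- x}"
    using pn by (auto simp: peak_def norm_T_nonneg Tw blinfun.minus_left blinfun.minus_right)
  then show "(\<lambda>s. max (w s) 0) \<in> peak {x}" "(\<lambda>s. max (- w s) 0) \<in> peak {- x}"
    by (simp_all add: p_def[abs_def] n_def[abs_def])
qed

text \<open>Bishop-Phelps for the normalised image of \<open>u - v\<close> gives a vector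
  \<open>z\<close> acting as a sign function, \<open>1\<close> on most of \<open>u\<close> and
  \<open>-1\<close> on most of \<open>v\<close>. This is the source of the Rademacher-like
  vectors.\<close>

lemma disjoint_pair_near_peaks:
  assumes u: "integrable M u" "\<And>s. 0 \<le> u s" and v: "integrable M v" "\<And>s. 0 \<le> v s"
    and disj: "\<And>s. u s = 0 \<or> v s = 0" and pos: "0 < (LINT s|M. u s)" and \<eta>: "0 < \<eta>"
  obtains z u' v' where "norm z = 1"
    "u' \<in> peak {z}" "\<And>s. u' s \<le> u s" "(LINT s|M. u s) - \<eta> \<le> (LINT s|M. u' s)"
    "v' \<in> peak {- z}" "\<And>s. v' s \<le> v s" "(LINT s|M. v s) - \<eta> \<le> (LINT s|M. v' s)"
proof -
  define N where "N = norm (T (\<lambda>s. u s - v s))"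
  have "\<bar>u s - v s\<bar> = u s + v s" for s using disj[of s] u(2)[of s] v(2)[of s] by auto
  then have "N = (LINT s|M. u s + v s)"
    unfolding N_def using u v by (simp add: norm_T)
  moreover have "0 \<le> (LINT s|M. v s)" using v by simp
  ultimately have N: "N > 0" using u v pos by (simp add: add_pos_nonneg)
  define \<phi> where "\<phi> = T (\<lambda>s. u s - v s) /\<^sub>R N"
  have "norm \<phi> = 1" using N by (simp add: \<phi>_def N_def)
  then obtain z g where z: "norm z = 1" "g \<in> state_space z" "norm (g - \<phi>) \<le> \<eta> / N"
    using bishop_phelps[of \<phi> "\<eta> / N"] \<eta> N by auto
  obtain w where w: "integrable M w" "T w = N *\<^sub>R g" using surj_T by metis
  have "blinfun_apply (T w) z = norm (T w)"
    using z(2) N by (simp add: w(2) state_space_def blinfun.scaleR_left)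
  note peak = pos_part_peak[OF w(1) _ this]
  have "T (\<lambda>s. w s - (u s - v s)) = N *\<^sub>R (g - \<phi>)"
    using w u v N by (simp add: T_diff \<phi>_def scaleR_right_diff_distrib)
  then have "(LINT s|M. \<bar>w s - (u s - v s)\<bar>) = N * norm (g - \<phi>)"
    using w u v N norm_T[of "\<lambda>s. w s - (u s - v s)"] by simp
  also have "\<dots> \<le> \<eta>" using z(3) N by (simp add: field_simps)
  finally have close: "(LINT s|M. \<bar>w s - (u s - v s)\<bar>) \<le> \<eta>" .
  \<comment> \<open>Cutting the parts of \<open>w\<close> off at \<open>u\<close> and
    \<open>v\<close> keeps them peaking. The loss is pointwise at most
    \<open>\<bar>w - (u - v)\<bar>\<close>, as \<open>u\<close> and \<open>v\<close> have disjoint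
    supports.\<close>
  define u' v' where "u' s = min (u s) (max (w s) 0)" and "v' s = min (v s) (max (- w s) 0)" for s
  have i: "integrable M u'" "integrable M v'" unfolding u'_def v'_def using u v w by auto
  show thesis
  proof (rule that[of z u' v'])
    show "u' \<in> peak {z}"
      by (rule peak_le[OF _ peak(1) i(1)]) (use z in \<open>auto simp: u'_def u\<close>)
    show "v' \<in> peak {- z}"
      by (rule peak_le[OF _ peak(2) i(2)]) (use z in \<open>auto simp: v'_def v\<close>)
    have "(LINT s|M. u s - u' s) \<le> (LINT s|M. \<bar>w s - (u s - v s)\<bar>)"
    proof (rule integral_mono)
      show "u s - u' s \<le> \<bar>w s - (u s - v s)\<bar>" for s
        using disj[of s] u(2)[of s] v(2)[of s] by (auto simp: u'_def min_def max_def abs_if)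
    qed (use u v w i in auto)
    then show "(LINT s|M. u s) - \<eta> \<le> (LINT s|M. u' s)" using close u i by simp
    have "(LINT s|M. v s - v' s) \<le> (LINT s|M. \<bar>w s - (u s - v s)\<bar>)"
    proof (rule integral_mono)
      show "v s - v' s \<le> \<bar>w s - (u s - v s)\<bar>" for s
        using disj[of s] u(2)[of s] v(2)[of s] by (auto simp: v'_def min_def max_def abs_if)
    qed (use u v w i in auto)
    then show "(LINT s|M. v s) - \<eta> \<le> (LINT s|M. v' s)" using close v i by simp
  qed (use z in \<open>auto simp: u'_def v'_def\<close>)
qed

end

text \<open>Stated for densities instead of sets: the finite measure with density \<open>u\<close>
  takes no values but \<open>0\<close> and its total mass.\<close>

definition L1_atom :: "'m measure \<Rightarrow> ('m \<Rightarrow> real) \<Rightarrow> bool" where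
  "L1_atom M u \<longleftrightarrow> integrable M u \<and> (\<forall>s. 0 \<le> u s) \<and> 0 < (LINT s|M. u s) \<and>
     (\<forall>A\<in>sets M. (LINT s|M. indicator A s * u s) = 0 \<or>
       (LINT s|M. indicator A s * u s) = (LINT s|M. u s))"

text \<open>A set witnessing the failure cuts \<open>u\<close> into two parts of positive mass; one
  carrying at least half of the mass is taken as \<open>w\<close>.\<close>

lemma not_L1_atom_split:
  fixes u :: "'m \<Rightarrow> real"
  assumes u: "integrable M u" "\<And>s. 0 \<le> u s" "0 < (LINT s|M. u s)" and "\<not> L1_atom M u"
  obtains v w where "integrable M v" "\<And>s. 0 \<le> v s" "0 < (LINT s|M. v s)"
    "integrable M w" "\<And>s. 0 \<le> w s" "(LINT s|M. u s) / 2 \<le> (LINT s|M. w s)"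
    "\<And>s. v s \<le> u s" "\<And>s. w s \<le> u s" "\<And>s. v s = 0 \<or> w s = 0"
proof -
  obtain A where A: "A \<in> sets M" "(LINT s|M. indicator A s * u s) \<noteq> 0"
    "(LINT s|M. indicator A s * u s) \<noteq> (LINT s|M. u s)"
    using assms unfolding L1_atom_def by blast
  define a b where "a s = indicator A s * u s" and "b s = u s - indicator A s * u s" for s
  have a: "integrable M a" "\<And>s. 0 \<le> a s" "\<And>s. a s \<le> u s"
    unfolding a_def using u integrable_mult_indicator[OF A(1) u(1)] by (auto simp: indicator_def)
  have b: "integrable M b" "\<And>s. 0 \<le> b s" "\<And>s. b s \<le> u s"
    unfolding b_def a_def[symmetric] using a u by auto
  have sum: "(LINT s|M. a s) + (LINT s|M. b s) = (LINT s|M. u s)"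
    unfolding b_def using a u by (simp add: a_def[symmetric])
  have "0 \<le> (LINT s|M. a s)" "0 \<le> (LINT s|M. b s)" using a b by simp_all
  then have pos: "0 < (LINT s|M. a s)" "0 < (LINT s|M. b s)"
    using A sum by (auto simp: a_def[abs_def] less_le)
  have disj: "a s = 0 \<or> b s = 0" for s by (auto simp: a_def b_def indicator_def)
  show thesis
  proof (cases "(LINT s|M. u s) / 2 \<le> (LINT s|M. b s)")
    case True
    then show ?thesis using that[of a b] a b pos disj by blast
  next
    case False
    then have "(LINT s|M. u s) / 2 \<le> (LINT s|M. a s)" using sum by simp
    moreover have "b s = 0 \<or> a s = 0" for s using disj by blast
    ultimately show ?thesis using that[of b a] a b pos by blast
  qed
qed

section \<open>The largest peaking part below a function\<close>

context L1_dual
begin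

definition max_peak :: "('m \<Rightarrow> real) \<Rightarrow> 'a set \<Rightarrow> real" where
  "max_peak f F = (SUP u\<in>{u \<in> peak F. u \<le> f}. LINT s|M. u s)"

lemma max_peak_upper:
  assumes "integrable M f" "u \<in> peak F" "u \<le> f"
  shows "(LINT s|M. u s) \<le> max_peak f F"
  unfolding max_peak_def
proof (rule cSUP_upper)
  show "bdd_above ((\<lambda>u. LINT s|M. u s) ` {u \<in> peak F. u \<le> f})"
    using assms(1) by (intro bdd_aboveI2[where M = "LINT s|M. f s"])
      (auto simp: peak_def le_fun_def intro!: integral_mono)
qed (use assms in auto)

lemma max_peak_least:
  assumes "\<And>s. 0 \<le> f s" "\<And>u. u \<in> peak F \<Longrightarrow> u \<le> f \<Longrightarrow> (LINT s|M. u s) \<le> c"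
  shows "max_peak f F \<le> c"
  unfolding max_peak_def
proof (rule cSUP_least)
  have "(\<lambda>s. 0) \<in> peak F"
    using T_scale[of "\<lambda>s. 0" 0] by (simp add: peak_def blinfun.zero_left)
  then show "{u \<in> peak F. u \<le> f} \<noteq> {}" using assms(1) by (auto simp: le_fun_def)
qed (use assms in auto)

lemma less_max_peakE:
  assumes "c < max_peak f F" "\<And>s. 0 \<le> f s"
  obtains u where "u \<in> peak F" "u \<le> f" "c < (LINT s|M. u s)"
  using max_peak_least[of f F c] assms by (meson not_le)

text \<open>An almost maximal \<open>u\<close> is split, and \<open>z\<close> separates the pieces:
  \<open>v'\<close> survives the new constraint at \<open>z\<close>, while functions peaking at
  \<open>z\<close> must avoid \<open>w'\<close> and so lose its mass.\<close>

lemma max_peak_decrease: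
  assumes f: "integrable M f" "\<And>s. 0 \<le> f s" and no_atom: "\<And>u. u \<le> f \<Longrightarrow> \<not> L1_atom M u"
    and F: "F \<subseteq> cball 0 1" and pos: "0 < max_peak f F"
  obtains z where "norm z = 1" "0 < max_peak f (insert z F)"
    "max_peak f (insert z F) \<le> 7 / 8 * max_peak f F"
proof -
  obtain u where u: "u \<in> peak F" "u \<le> f" "max_peak f F / 2 < (LINT s|M. u s)"
    using less_max_peakE[of "max_peak f F / 2" f F] f(2) pos by auto
  note u' = peakD[OF u(1)]
  have upos: "0 < (LINT s|M. u s)" using u(3) pos by simp
  obtain v w where v: "integrable M v" "\<And>s. 0 \<le> v s" "0 < (LINT s|M. v s)"
    and w: "integrable M w" "\<And>s. 0 \<le> w s" "(LINT s|M. u s) / 2 \<le> (LINT s|M. w s)"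
    and le: "\<And>s. v s \<le> u s" "\<And>s. w s \<le> u s" and disj: "\<And>s. v s = 0 \<or> w s = 0"
    by (rule not_L1_atom_split[OF u'(1,2) upos no_atom[OF u(2)]]) blast
  \<comment> \<open>The first bound keeps \<open>v'\<close> nonzero. The second leaves
    \<open>w'\<close> at least a quarter of the mass of \<open>u\<close>, hence an eighth of
    \<open>max_peak f F\<close>.\<close>
  define \<eta> where "\<eta> = min ((LINT s|M. v s) / 2) ((LINT s|M. u s) / 4)"
  have \<eta>: "0 < \<eta>" using v(3) upos by (simp add: \<eta>_def)
  obtain z v' w' where z: "norm z = 1"
    and v': "v' \<in> peak {z}" "\<And>s. v' s \<le> v s" "(LINT s|M. v s) - \<eta> \<le> (LINT s|M. v' s)"
    and w': "w' \<in> peak {- z}" "\<And>s. w' s \<le> w s" "(LINT s|M. w s) - \<eta> \<le> (LINT s|M. w' s)"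
    by (rule disjoint_pair_near_peaks[OF v(1,2) w(1,2) disj v(3) \<eta>]) blast
  have peaks: "v' \<in> peak F" "w' \<in> peak F"
    using le v'(2) w'(2) order_trans
    by (auto intro!: peak_le[OF F u(1)] peakD[OF v'(1)] peakD[OF w'(1)]) blast+
  have lef: "v' \<le> f" "w' \<le> f"
    using le v'(2) w'(2) u(2) by (auto simp: le_fun_def) (meson order_trans)+
  show thesis
  proof (rule that[OF z])
    have "v' \<in> peak (insert z F)" using v'(1) peaks by (simp add: peak_insert[of _ z F])
    from max_peak_upper[OF f(1) this lef(1)]
    show "0 < max_peak f (insert z F)" using v'(3) v(3) by (simp add: \<eta>_def min_def split: if_splits)
    show "max_peak f (insert z F) \<le> 7 / 8 * max_peak f F"
    proof (rule max_peak_least[OF f(2)])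
      fix s assume s: "s \<in> peak (insert z F)" "s \<le> f"
      then have sF: "s \<in> peak {z}" "s \<in> peak F" by (auto simp: peak_insert[of _ z F])
      note s' = peakD[OF s(1)] and w'' = peakD[OF w'(1)]
      define k where "k t = min (s t) (w' t)" for t
      have k: "integrable M k" "\<And>t. 0 \<le> k t" unfolding k_def using s' w'' by auto
      have "k \<in> peak {z}" "k \<in> peak {- z}"
        using z by (auto intro!: peak_le[OF _ sF(1)] peak_le[OF _ w'(1)] k simp: k_def)
      \<comment> \<open>The integral is both the value of \<open>T k\<close> at \<open>z\<close> and
        its negative. Hence the maximum of \<open>s\<close> and \<open>w'\<close>, which peaks on
        \<open>F\<close>, carries the sum of their masses.\<close>
      then have "(LINT t|M. k t) = 0" by (auto simp: peak_def blinfun.minus_right)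
      moreover have "(LINT t|M. max (s t) (w' t)) = (LINT t|M. s t + w' t - k t)"
        by (intro Bochner_Integration.integral_cong) (auto simp: k_def)
      moreover have "(LINT t|M. max (s t) (w' t)) \<le> max_peak f F"
        using s(2) lef(2) by (intro max_peak_upper f peak_max F sF peaks) (auto simp: le_fun_def)
      ultimately have "(LINT t|M. s t) + (LINT t|M. w' t) \<le> max_peak f F"
        using s' w'' k by simp
      moreover have "\<eta> \<le> (LINT s|M. u s) / 4" by (simp add: \<eta>_def)
      ultimately show "(LINT t|M. s t) \<le> 7 / 8 * max_peak f F" using u(3) w(3) w'(3) by linarith
    qed
  qed
qed

text \<open>
  Otherwise there are unit vectors \<open>z\<^sub>n\<close> such that the largest part of \<open>f\<close> on which
  \<open>z\<^sub>0, \<dots>, z\<^sub>n\<close> all attain their norm is nonzero for every \<open>n\<close> but tends to \<open>0\<close>. At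
  \<open>\<Sum>n. 2\<^bsup>-(n+1)\<^esup> z\<^sub>n\<close> these parts are almost states but are far from all states.
\<close>

theorem exists_L1_atom_below:
  assumes ssd: "\<And>x::'a. norm x = 1 \<Longrightarrow> ssd_at x"
    and f: "integrable M f" "\<And>s. 0 \<le> f s" "0 < (LINT s|M. f s)"
  shows "\<exists>u. L1_atom M u \<and> u \<le> f"
proof (rule ccontr)
  assume "\<nexists>u. L1_atom M u \<and> u \<le> f"
  then have no_atom: "\<not> L1_atom M u" if "u \<le> f" for u using that by blast
  \<comment> \<open>The clause for \<open>n = 0\<close> fixes the start of the sequence produced by
    dependent choice.\<close>
  define P where "P n F \<longleftrightarrow> F \<subseteq> cball 0 1 \<and> 0 < max_peak f F \<and> (n = 0 \<longrightarrow> F = {})"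
    for n :: nat and F
  define Q where "Q F F' \<longleftrightarrow> (\<exists>z. norm z = 1 \<and> F' = insert z F \<and> max_peak f F' \<le> 7 / 8 * max_peak f F)"
    for F F'
  have "P 0 {}"
    using max_peak_upper[of f f "{}"] f by (simp add: P_def peak_def)
  moreover have "\<exists>F'. P (Suc n) F' \<and> Q F F'" if F: "P n F" for n F
  proof -
    obtain z where "norm z = 1" "0 < max_peak f (insert z F)"
      "max_peak f (insert z F) \<le> 7 / 8 * max_peak f F"
      by (rule max_peak_decrease[OF f(1,2) no_atom, of F]) (use F in \<open>auto simp: P_def\<close>)
    then show ?thesis using F unfolding P_def Q_def by (intro exI[of _ "insert z F"]) auto
  qed
  ultimately obtain F where F: "\<And>n. P n (F n)" "\<And>n. Q (F n) (F (Suc n))"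
    using dependent_nat_choice[of P "\<lambda>n. Q"] by metis
  then have "\<forall>n. \<exists>z. norm z = 1 \<and> F (Suc n) = insert z (F n)" unfolding Q_def by blast
  then obtain z where z: "\<And>n. norm (z n) = 1" "\<And>n. F (Suc n) = insert (z n) (F n)" by metis
  have F_eq: "F n = z ` {..<n}" for n
    by (induction n) (use F(1)[of 0] z in \<open>auto simp: P_def lessThan_Suc\<close>)
  have le: "max_peak f (F n) \<le> (7 / 8) ^ n * max_peak f (F 0)" for n
  proof (induction n)
    case (Suc n)
    have "max_peak f (F (Suc n)) \<le> 7 / 8 * max_peak f (F n)" using F(2)[of n] by (auto simp: Q_def)
    then show ?case using Suc by simp
  qed simp
  have "(\<lambda>n. (7 / 8) ^ n * max_peak f (F 0)) \<longlonglongrightarrow> 0 * max_peak f (F 0)"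
    by (intro tendsto_mult_right LIMSEQ_power_zero) auto
  then have to0: "(\<lambda>n. (7 / 8) ^ n * max_peak f (F 0)) \<longlonglongrightarrow> 0" by simp
  \<comment> \<open>The weights are positive with sum 1, so a function peaking at \<open>x\<close>
    must peak at every \<open>z n\<close>.\<close>
  define x where "x = (\<Sum>n. (1/2) ^ Suc n *\<^sub>R z n)"
  have sn: "summable (\<lambda>n. norm ((1/2) ^ Suc n *\<^sub>R z n))"
    using sums_summable[OF power_half_series] z by simp
  have nx: "norm x \<le> 1"
    using summable_norm[OF sn] sums_unique[OF power_half_series] z by (simp add: x_def)
  have Tx: "(\<lambda>n. (1/2::real) ^ Suc n * blinfun_apply g (z n)) sums blinfun_apply g x" for g
    using bounded_linear.sums[OF blinfun.bounded_linear_right summable_sums[OF summable_norm_cancel[OF sn]], of g]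
    by (simp add: x_def blinfun.scaleR_right)
  have gz: "\<bar>blinfun_apply g (z n)\<bar> \<le> norm g" for g n
    using norm_blinfun[of g "z n"] z by simp
  \<comment> \<open>A function peaking at the first \<open>k\<close> vectors has a defect at
    \<open>x\<close> only through the tail, of total weight \<open>(1/2) ^ k\<close>, where each
    defect is at most \<open>2 * N\<close>.\<close>
  have approx: "\<exists>u. u \<in> peak (F k) \<and> u \<le> f \<and> 0 < (LINT s|M. u s) \<and>
      blinfun_apply (T u) x \<ge> (1 - 2 * (1/2) ^ k) * (LINT s|M. u s)" for k
  proof -
    obtain u where u: "u \<in> peak (F k)" "u \<le> f" "0 < (LINT s|M. u s)"
      using less_max_peakE[of 0 f "F k"] F(1)[of k] f(2) unfolding P_def by blast
    define N where "N = (LINT s|M. u s)"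
    have nT: "norm (T u) = N" using peakD[OF u(1)] by (simp add: N_def norm_T_nonneg)
    have "(\<lambda>n. (1/2) ^ Suc n * (N - blinfun_apply (T u) (z n))) sums (1 * N - blinfun_apply (T u) x)"
      using sums_diff[OF sums_mult2[OF power_half_series, of N] Tx[of "T u"]]
      by (simp only: right_diff_distrib)
    moreover have "(\<lambda>n. if n < k then 0 else (1/2) ^ Suc n * (2 * N)) sums ((1/2) ^ k * (2 * N))"
    proof -
      have "(\<lambda>n. (1/2) ^ Suc n * ((1/2) ^ k * (2 * N))) sums (1 * ((1/2) ^ k * (2 * N)))"
        by (intro sums_mult2 power_half_series)
      moreover define G where "G n = (if n < k then 0 else (1/2) ^ Suc n * (2 * N))" for n
      ultimately have "(\<lambda>n. G (n + k)) sums ((1/2) ^ k * (2 * N))"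
        by (simp add: power_add mult_ac)
      then have "G sums ((1/2) ^ k * (2 * N) + (\<Sum>n<k. G n))" by (simp only: sums_iff_shift)
      then have "G sums ((1/2) ^ k * (2 * N))" by (simp add: G_def)
      then show ?thesis unfolding G_def[abs_def] .
    qed
    moreover have "(1/2) ^ Suc n * (N - blinfun_apply (T u) (z n))
        \<le> (if n < k then 0 else (1/2) ^ Suc n * (2 * N))" for n
    proof (cases "n < k")
      case True
      then have "blinfun_apply (T u) (z n) = N" using peakD(3)[OF u(1)] by (simp add: F_eq N_def)
      then show ?thesis using True by simp
    next
      case False
      have "N - blinfun_apply (T u) (z n) \<le> 2 * N" using gz[of "T u" n] nT by linarith
      then show ?thesis using False by simp
    qed
    ultimately have "1 * N - blinfun_apply (T u) x \<le> (1/2) ^ k * (2 * N)"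
      by (meson sums_le)
    then show ?thesis using u by (intro exI[of _ u]) (simp add: N_def algebra_simps)
  qed
  have pow0: "(\<lambda>k. 2 * (1/2::real) ^ k) \<longlonglongrightarrow> 0"
    using tendsto_mult_left[OF LIMSEQ_power_zero[of "1/2::real"], of 2] by simp
  have lower: "1 - 2 * (1/2) ^ k \<le> norm x" for k
  proof -
    obtain u where u: "u \<in> peak (F k)" "0 < (LINT s|M. u s)"
      "blinfun_apply (T u) x \<ge> (1 - 2 * (1/2) ^ k) * (LINT s|M. u s)" using approx by blast
    have "blinfun_apply (T u) x \<le> (LINT s|M. u s) * norm x"
      using norm_blinfun[of "T u" x] peakD[OF u(1)] by (simp add: norm_T_nonneg)
    with u(3) have "(1 - 2 * (1/2) ^ k) * (LINT s|M. u s) \<le> norm x * (LINT s|M. u s)"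
      by (simp add: mult.commute)
    then show ?thesis using u(2) by simp
  qed
  have "(\<lambda>k. 1 - 2 * (1/2::real) ^ k) \<longlonglongrightarrow> 1 - 0" by (intro tendsto_diff tendsto_const pow0)
  then have "1 \<le> norm x" using lower by (intro LIMSEQ_le_const2) auto
  then have x1: "norm x = 1" using nx by simp
  \<comment> \<open>Distance at most \<open>1/2\<close> forces the normalised function to share at
    least half of its mass with the positive part of the state.\<close>
  obtain \<delta> where \<delta>: "\<delta> > 0"
    "\<And>\<phi>. norm \<phi> = 1 \<Longrightarrow> blinfun_apply \<phi> x > 1 - \<delta> \<Longrightarrow> \<exists>g\<in>state_space x. norm (g - \<phi>) \<le> 1/2"
    using ssd_at_strongly_exposed[OF ssd[OF x1] x1, of "1/2"] by auto
  obtain k where k: "2 * (1/2::real) ^ k < \<delta>"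
    using order_tendstoD(2)[OF pow0 \<delta>(1)] by (meson eventually_sequentially order_refl)
  obtain u where u: "u \<in> peak (F k)" "u \<le> f" "0 < (LINT s|M. u s)"
    "blinfun_apply (T u) x \<ge> (1 - 2 * (1/2) ^ k) * (LINT s|M. u s)" using approx by blast
  define N where "N = (LINT s|M. u s)"
  have N: "N > 0" using u by (simp add: N_def)
  note u' = peakD[OF u(1)]
  define v where "v s = inverse N * u s" for s
  have v: "integrable M v" "\<And>s. 0 \<le> v s" "(LINT s|M. v s) = 1"
    using u' N by (auto simp: v_def[abs_def] N_def)
  have Tv: "T v = inverse N *\<^sub>R T u" unfolding v_def[abs_def] using u' by (intro T_scale)
  have "blinfun_apply (T v) x \<ge> 1 - 2 * (1/2) ^ k"
    using u(4) N by (simp add: Tv blinfun.scaleR_left N_def[symmetric] field_simps)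
  then obtain g where g: "g \<in> state_space x" "norm (g - T v) \<le> 1/2"
    using \<delta>(2)[of "T v"] v k by (auto simp: norm_T_nonneg)
  obtain w where w: "integrable M w" "T w = g" using surj_T by metis
  define h where "h s = min (v s) (max (w s) 0)" for s
  have h: "integrable M h" "\<And>s. 0 \<le> h s" "\<And>s. h s \<le> v s"
    unfolding h_def using v w by auto
  have "blinfun_apply (T w) x = norm (T w)" using g(1) w by (simp add: state_space_def)
  note w_peak = pos_part_peak(1)[OF w(1) nx this]
  have hx: "h \<in> peak {x}"
    by (rule peak_le[OF _ w_peak h(1,2)]) (use nx in \<open>auto simp: h_def\<close>)
  have "(LINT s|M. v s - h s) \<le> (LINT s|M. \<bar>w s - v s\<bar>)"
    using v h w by (intro integral_mono) (auto simp: h_def)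
  also have "\<dots> \<le> 1/2" using g(2) norm_T[of "\<lambda>s. w s - v s"] w v by (simp add: T_diff)
  finally have hpos: "(LINT s|M. h s) \<ge> 1/2" using v h by simp
  define H where "H = (LINT s|M. h s)"
  have nTh: "norm (T h) = H" using h by (simp add: norm_T_nonneg H_def)
  have "(\<lambda>n. (1/2) ^ Suc n * (H - blinfun_apply (T h) (z n))) sums (1 * H - blinfun_apply (T h) x)"
    using sums_diff[OF sums_mult2[OF power_half_series, of H] Tx[of "T h"]]
    by (simp only: right_diff_distrib)
  then have sums0: "(\<lambda>n. (1/2) ^ Suc n * (H - blinfun_apply (T h) (z n))) sums 0"
    using peakD(3)[OF hx] by (simp add: H_def)
  have nonneg: "0 \<le> (1/2) ^ Suc n * (H - blinfun_apply (T h) (z n))" for n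
    using gz[of "T h" n] nTh by (simp add: abs_le_iff)
  \<comment> \<open>Nonnegative terms with sum zero vanish: \<open>h\<close> peaks at all
    \<open>z n\<close> at once.\<close>
  have "\<forall>n. (1/2) ^ Suc n * (H - blinfun_apply (T h) (z n)) = 0"
    using suminf_eq_zero_iff[OF sums_summable[OF sums0] nonneg] sums_unique[OF sums0] by simp
  then have hF: "h \<in> peak (F n)" for n using h by (simp add: peak_def F_eq H_def)
  \<comment> \<open>The factor \<open>N\<close> undoes the normalisation, so \<open>N h\<close> lies
    below \<open>f\<close>. Its fixed positive mass contradicts the geometric decay of
    \<open>max_peak f (F n)\<close>.\<close>
  have "N * (LINT s|M. h s) \<le> max_peak f (F n)" for n
  proof -
    have "N * h s \<le> f s" for s
    proof -
      have "N * h s \<le> N * v s" using h(3) N by simp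
      also have "\<dots> = u s" using N by (simp add: v_def)
      also have "\<dots> \<le> f s" using u(2) by (simp add: le_fun_def)
      finally show ?thesis .
    qed
    then have "(LINT s|M. N * h s) \<le> max_peak f (F n)"
      using peak_scale[OF hF, of N] N by (intro max_peak_upper f) (auto simp: le_fun_def)
    then show ?thesis by simp
  qed
  then have "N * (LINT s|M. h s) \<le> (7 / 8) ^ n * max_peak f (F 0)" for n using le order_trans by blast
  then have "N * (LINT s|M. h s) \<le> 0" by (intro LIMSEQ_le_const[OF to0]) auto
  moreover have "0 < N * (LINT s|M. h s)" using N hpos by simp
  ultimately show False by simp
qed

end

section \<open>Decomposition into atoms\<close>

context L1_isometry
begin

lemma T_cong_AE:
  assumes "integrable M f" "integrable M g" "AE s in M. f s = g s"
  shows "T f = T g"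
proof -
  have "norm (T f - T g) = (LINT s|M. \<bar>f s - g s\<bar>)"
    using assms norm_T[of "\<lambda>s. f s - g s"] by (simp add: T_diff)
  also have "\<dots> = (LINT s|M. 0)"
    using assms by (intro integral_cong_AE) auto
  finally show ?thesis by simp
qed

text \<open>With \<open>c = \<integral>w / \<integral>u\<close>, the set where \<open>w > c u\<close> carries all or nothing of \<open>u\<close>, so \<open>w\<close> and
  \<open>c u\<close> are comparable almost everywhere; having equal integrals, they agree.\<close>

lemma below_L1_atom:
  assumes atom: "L1_atom M u" and w: "integrable M w" "\<And>s. 0 \<le> w s" "\<And>s. w s \<le> u s"
  shows "T w = ((LINT s|M. w s) / (LINT s|M. u s)) *\<^sub>R T u"
proof -
  define c where "c = (LINT s|M. w s) / (LINT s|M. u s)"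
  have u: "integrable M u" "\<And>s. 0 \<le> u s" "0 < (LINT s|M. u s)" using atom by (auto simp: L1_atom_def)
  have eq: "(LINT s|M. w s) = (LINT s|M. c * u s)" using u by (simp add: c_def)
  have c: "0 \<le> c" using u w by (simp add: c_def)
  define A where "A = {s \<in> space M. c * u s < w s}"
  have A: "A \<in> sets M" unfolding A_def using u w by measurable
  have iA: "integrable M (\<lambda>s. indicator A s * u s)" using integrable_mult_indicator[OF A u(1)] by simp
  have "(AE s in M. w s \<le> c * u s) \<or> (AE s in M. c * u s \<le> w s)"
  proof (cases "(LINT s|M. indicator A s * u s) = 0")
    case True
    then have "AE s in M. indicator A s * u s = 0"
      using integral_nonneg_eq_0_iff_AE[OF iA] u(2) by simp
    with AE_space have "AE s in M. w s \<le> c * u s"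
    proof eventually_elim
      case (elim s)
      show ?case
      proof (rule ccontr)
        assume *: "\<not> w s \<le> c * u s"
        then have "u s = 0" using elim by (simp add: A_def)
        then show False using * w(3)[of s] by simp
      qed
    qed
    then show ?thesis ..
  next
    case False
    then have "(LINT s|M. indicator A s * u s) = (LINT s|M. u s)" using atom A by (auto simp: L1_atom_def)
    then have "(LINT s|M. u s - indicator A s * u s) = 0" using u iA by simp
    moreover have "0 \<le> u s - indicator A s * u s" for s using u(2)[of s] by (auto simp: indicator_def)
    ultimately have "AE s in M. u s - indicator A s * u s = 0"
      using integral_nonneg_eq_0_iff_AE[of M "\<lambda>s. u s - indicator A s * u s"] u iA by simp
    with AE_space have "AE s in M. c * u s \<le> w s"
    proof eventually_elim
      case (elim s)
      show ?case
      proof (cases "s \<in> A")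
        case False
        then have "u s = 0" using elim by simp
        then show ?thesis using w(2)[of s] by simp
      qed (simp add: A_def)
    qed
    then show ?thesis ..
  qed
  then have "AE s in M. w s = c * u s"
  proof
    assume *: "AE s in M. w s \<le> c * u s"
    have "AE s in M. c * u s - w s = 0"
      using * integral_nonneg_eq_0_iff_AE[of M "\<lambda>s. c * u s - w s"] u w eq by simp
    then show ?thesis by eventually_elim simp
  next
    assume *: "AE s in M. c * u s \<le> w s"
    have "AE s in M. w s - c * u s = 0"
      using * integral_nonneg_eq_0_iff_AE[of M "\<lambda>s. w s - c * u s"] u w eq by simp
    then show ?thesis by eventually_elim simp
  qed
  then have "T w = T (\<lambda>s. c * u s)" using u w by (intro T_cong_AE) auto
  then show ?thesis unfolding c_def[symmetric] using u by (simp add: T_scale)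
qed

definition unit_atom :: "('m \<Rightarrow> real) \<Rightarrow> bool" where
  "unit_atom u \<longleftrightarrow> L1_atom M u \<and> (LINT s|M. u s) = 1"

lemma unit_atomD:
  assumes "unit_atom u"
  shows "L1_atom M u" "integrable M u" "0 \<le> u s" "(LINT s|M. u s) = 1" "norm (T u) = 1"
  using assms by (auto simp: unit_atom_def L1_atom_def norm_T_nonneg)

lemma unit_atom_normalize:
  assumes "L1_atom M u"
  shows "unit_atom (\<lambda>s. inverse (LINT s|M. u s) * u s)"
proof -
  define c where "c = inverse (LINT s|M. u s)"
  have u: "integrable M u" "\<And>s. 0 \<le> u s" "0 < (LINT s|M. u s)" using assms by (auto simp: L1_atom_def)
  have c: "0 < c" "c * (LINT s|M. u s) = 1" using u by (auto simp: c_def)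
  have eq: "(LINT s|M. indicator A s * (c * u s)) = c * (LINT s|M. indicator A s * u s)" for A
    by (subst integral_mult_right_zero[symmetric]) (simp add: mult_ac)
  show ?thesis
    using assms u c unfolding unit_atom_def L1_atom_def c_def[symmetric] by (auto simp: eq)
qed

text \<open>The minimum lies below both atoms, so its image is the same multiple of
  \<open>T u\<close> and of \<open>T v\<close>; distinct images force that multiple, its integral,
  to vanish.\<close>

lemma unit_atoms_disjoint:
  assumes u: "unit_atom u" and v: "unit_atom v" and ne: "T u \<noteq> T v"
  shows "AE s in M. min (u s) (v s) = 0"
proof -
  note u' = unit_atomD[OF u] and v' = unit_atomD[OF v]
  define w where "w s = min (u s) (v s)" for s
  have w: "integrable M w" "\<And>s. 0 \<le> w s" "\<And>s. w s \<le> u s" "\<And>s. w s \<le> v s"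
    unfolding w_def using u' v' by auto
  have "T w = (LINT s|M. w s) *\<^sub>R T u" "T w = (LINT s|M. w s) *\<^sub>R T v"
    using below_L1_atom[OF u'(1) w(1,2,3)] below_L1_atom[OF v'(1) w(1,2,4)] u'(4) v'(4) by auto
  then have "(LINT s|M. w s) = 0" using ne by auto
  then have "AE s in M. w s = 0"
    using integral_nonneg_eq_0_iff_AE[OF w(1)] w(2) by simp
  then show ?thesis by (simp add: w_def)
qed

text \<open>Taking images identifies atoms that agree almost everywhere, and gives an index set
  inside the target space, as \<open>dual_is_l1\<close> asks.\<close>

definition atom_set :: "'b set" where
  "atom_set = T ` {u. unit_atom u}"

lemma norm_atom_set: "e \<in> atom_set \<Longrightarrow> norm e = 1"
  by (auto simp: atom_set_def unit_atomD)

text \<open>Finitely many distinct atoms have representatives that are pairwise disjoint almost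
  everywhere. So at almost every point at most one term is nonzero, and absolute values pass through
  the sum.\<close>

lemma norm_sum_atom_set:
  assumes F: "finite F" "F \<subseteq> atom_set"
  shows "norm (\<Sum>e\<in>F. c e *\<^sub>R e) = (\<Sum>e\<in>F. \<bar>c e\<bar>)"
proof -
  have "\<forall>e\<in>F. \<exists>u. unit_atom u \<and> T u = e" using F by (auto simp: atom_set_def)
  then obtain U where U: "\<And>e. e \<in> F \<Longrightarrow> unit_atom (U e)" "\<And>e. e \<in> F \<Longrightarrow> T (U e) = e" by metis
  note U' = unit_atomD[OF U(1)]
  have "AE s in M. \<forall>e\<in>F. \<forall>e'\<in>F. e \<noteq> e' \<longrightarrow> min (U e s) (U e' s) = 0"
    using F U by (intro AE_finite_allI) (auto intro!: unit_atoms_disjoint)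
  then have AE: "AE s in M. \<bar>\<Sum>e\<in>F. c e * U e s\<bar> = (\<Sum>e\<in>F. \<bar>c e\<bar> * U e s)"
  proof eventually_elim
    case (elim s)
    show ?case
    proof (cases "\<exists>e\<in>F. U e s \<noteq> 0")
      case True
      then obtain e where e: "e \<in> F" "U e s \<noteq> 0" by blast
      have "U e' s = 0" if "e' \<in> F - {e}" for e'
        using elim e that U'(3)[of e s] U'(3)[of e' s] by (force simp: min_def split: if_splits)
      then show ?thesis
        using U'(3)[OF e(1), of s] by (simp add: sum.remove[OF F(1) e(1)] abs_mult)
    qed auto
  qed
  have "(\<Sum>e\<in>F. c e *\<^sub>R e) = T (\<lambda>s. \<Sum>e\<in>F. c e * U e s)"
    using F U U' by (subst T_sum) (auto simp: T_scale)
  then have "norm (\<Sum>e\<in>F. c e *\<^sub>R e) = (LINT s|M. \<bar>\<Sum>e\<in>F. c e * U e s\<bar>)"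
    using U' by (simp add: norm_T)
  also have "\<dots> = (LINT s|M. (\<Sum>e\<in>F. \<bar>c e\<bar> * U e s))"
    using AE U' by (intro integral_cong_AE) auto
  also have "\<dots> = (\<Sum>e\<in>F. \<bar>c e\<bar>)"
    using U' by simp
  finally show ?thesis .
qed

end

section \<open>Absolutely summable families and greedy expansion into atoms\<close>

lemma l1_space_add:
  assumes "f \<in> l1_space \<Gamma>" "g \<in> l1_space \<Gamma>"
  shows "(\<lambda>i. f i + g i) \<in> l1_space \<Gamma>"
proof -
  have "(\<lambda>i. \<bar>f i + g i\<bar>) summable_on \<Gamma>"
    by (rule summable_on_comparison_test[of "\<lambda>i. \<bar>f i\<bar> + \<bar>g i\<bar>"])
      (use assms in \<open>auto simp: l1_space_def intro: summable_on_add\<close>)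
  then show ?thesis using assms by (simp add: l1_space_def)
qed

lemma l1_space_scale: "f \<in> l1_space \<Gamma> \<Longrightarrow> (\<lambda>i. c * f i) \<in> l1_space \<Gamma>"
  by (auto simp: l1_space_def abs_mult intro: summable_on_cmult_right)

text \<open>Strong subdifferentiability enters the decomposition only through
  \<open>atom_below\<close>.\<close>

locale atomic_L1 = L1_isometry M T for M :: "'m measure" and T :: "('m \<Rightarrow> real) \<Rightarrow> 'b::banach" +
  assumes atom_below: "integrable M f \<Longrightarrow> (\<And>s. 0 \<le> f s) \<Longrightarrow> 0 < (LINT s|M. f s) \<Longrightarrow> \<exists>u. L1_atom M u \<and> u \<le> f"
begin

lemma unit_atom_below:
  assumes f: "integrable M f" "\<And>s. 0 \<le> f s" "0 < (LINT s|M. f s)"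
  obtains d u where "d > 0" "unit_atom u" "\<And>s. d * u s \<le> f s"
proof -
  obtain u where u: "L1_atom M u" "u \<le> f" using atom_below[OF f] by blast
  then have "0 < (LINT s|M. u s)" by (simp add: L1_atom_def)
  with u unit_atom_normalize[OF u(1)] show thesis
    by (intro that[of "LINT s|M. u s" "\<lambda>s. inverse (LINT s|M. u s) * u s"]) (auto simp: le_fun_def mult.assoc[symmetric])
qed

text \<open>A coefficient within a factor 2 of the supremum avoids the question whether the supremum
  is attained. If no positive multiple of an atom fits below \<open>r\<close>, it is
  \<open>0\<close>.\<close>

lemma greedy_step:
  assumes ex: "\<exists>u. unit_atom u" and r: "integrable M r" "\<And>s. 0 \<le> r s"
  obtains d v where "0 \<le> d" "unit_atom v" "\<And>s. d * v s \<le> r s"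
    "\<And>d' v'. 0 \<le> d' \<Longrightarrow> unit_atom v' \<Longrightarrow> (\<And>s. d' * v' s \<le> r s) \<Longrightarrow> d' \<le> 2 * d"
proof -
  define S where "S = {d. 0 \<le> d \<and> (\<exists>v. unit_atom v \<and> (\<forall>s. d * v s \<le> r s))}"
  have S0: "0 \<in> S" using ex r by (auto simp: S_def)
  have "d \<le> (LINT s|M. r s)" if d: "d \<in> S" for d
  proof -
    obtain v where v: "unit_atom v" "\<forall>s. d * v s \<le> r s" using d unfolding S_def by blast
    have "(LINT s|M. d * v s) \<le> (LINT s|M. r s)"
      using v r unit_atomD[OF v(1)] by (intro integral_mono) auto
    then show ?thesis using unit_atomD[OF v(1)] by simp
  qed
  then have bdd: "bdd_above S" by (rule bdd_aboveI)
  have "\<exists>d\<in>S. Sup S \<le> 2 * d"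
  proof (cases "Sup S \<le> 0")
    case True
    then show ?thesis using S0 by (intro bexI[of _ 0]) auto
  next
    case False
    then have "Sup S / 2 < Sup S" by simp
    then obtain d where "d \<in> S" "Sup S / 2 < d" using less_cSup_iff[OF _ bdd] S0 by blast
    then show ?thesis by (intro bexI[of _ d]) auto
  qed
  then obtain d where d: "d \<in> S" "Sup S \<le> 2 * d" by blast
  then obtain v where v: "0 \<le> d" "unit_atom v" "\<forall>s. d * v s \<le> r s" unfolding S_def by blast
  show thesis
  proof (rule that[OF v(1,2)])
    show "d * v s \<le> r s" for s using v(3) by blast
    fix d' v' assume "0 \<le> d'" "unit_atom v'" "\<And>s. d' * v' s \<le> r s"
    then have "d' \<in> S" by (auto simp: S_def)
    then show "d' \<le> 2 * d" using cSup_upper[OF _ bdd] d(2) by (meson order_trans)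
  qed
qed

text \<open>Atoms are subtracted greedily. A multiple \<open>d'\<close> of a unit atom below the
  limit of the remainders would fit below each remainder, so \<open>d' \<le> 2 * d n\<close>, which
  tends to zero. Hence the limit has integral zero.\<close>

lemma atomic_expansion:
  assumes f: "integrable M f" "\<And>s. 0 \<le> f s" "0 < (LINT s|M. f s)"
  obtains d e where "\<And>n::nat. 0 \<le> d n" "\<And>n. e n \<in> atom_set" "summable d"
    "(\<lambda>n. d n *\<^sub>R e n) sums T f"
proof -
  have ex: "\<exists>u. unit_atom u" using unit_atom_below[OF f] by blast
  define P where "P n r \<longleftrightarrow> integrable M r \<and> (\<forall>s. 0 \<le> r s) \<and> (n = 0 \<longrightarrow> r = f)"
    for n :: nat and r
  define R where "R r d v r' \<longleftrightarrow> 0 \<le> d \<and> unit_atom v \<and> r' = (\<lambda>s. r s - d * v s) \<and>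
      (\<forall>d' v'. 0 \<le> d' \<longrightarrow> unit_atom v' \<longrightarrow> (\<forall>s. d' * v' s \<le> r s) \<longrightarrow> d' \<le> 2 * d)" for r d v r'
  have "P 0 f" using f by (simp add: P_def)
  moreover have "\<exists>r'. P (Suc n) r' \<and> (\<exists>d v. R r d v r')" if "P n r" for n r
  proof -
    have r: "integrable M r" "\<And>s. 0 \<le> r s" using that by (auto simp: P_def)
    obtain d v where dv: "0 \<le> d" "unit_atom v" "\<And>s. d * v s \<le> r s"
      "\<And>d' v'. 0 \<le> d' \<Longrightarrow> unit_atom v' \<Longrightarrow> (\<And>s. d' * v' s \<le> r s) \<Longrightarrow> d' \<le> 2 * d"
      by (rule greedy_step[OF ex r]) blast
    then show ?thesis using r unit_atomD[OF dv(2)] unfolding P_def R_def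
      by (intro exI[of _ "\<lambda>s. r s - d * v s"] conjI exI[of _ d] exI[of _ v]) auto
  qed
  ultimately obtain r where rP: "\<And>n. P n (r n)" and "\<And>n. \<exists>d v. R (r n) d v (r (Suc n))"
    using dependent_nat_choice[of P "\<lambda>n r r'. \<exists>d v. R r d v r'"] by metis
  then obtain d v where R: "\<And>n. R (r n) (d n) (v n) (r (Suc n))" by metis
  have r: "integrable M (r n)" "0 \<le> r n s" "r 0 = f" for n s using rP by (auto simp: P_def)
  have d: "0 \<le> d n" and v: "unit_atom (v n)" and rS: "r (Suc n) s = r n s - d n * v n s"
    and max: "\<And>d' v'. 0 \<le> d' \<Longrightarrow> unit_atom v' \<Longrightarrow> (\<And>s. d' * v' s \<le> r n s) \<Longrightarrow> d' \<le> 2 * d n" for n s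
    using R[of n] by (auto simp: R_def)
  note v' = unit_atomD[OF v]
  have Tr: "T (r n) = T f - (\<Sum>i<n. d i *\<^sub>R T (v i))" for n
  proof (induction n)
    case (Suc n)
    have "T (r (Suc n)) = T (r n) - d n *\<^sub>R T (v n)"
      unfolding rS[abs_def] using r v' by (simp add: T_diff T_scale)
    with Suc show ?case by simp
  qed (simp add: r)
  have Ir: "(LINT s|M. r n s) = (LINT s|M. f s) - (\<Sum>i<n. d i)" for n
  proof (induction n)
    case (Suc n)
    have "(LINT s|M. r (Suc n) s) = (LINT s|M. r n s) - d n"
      unfolding rS using r v' by simp
    with Suc show ?case by simp
  qed (simp add: r)
  have Ir0: "0 \<le> (LINT s|M. r n s)" for n using r by simp
  have "(\<Sum>i<n. d i) \<le> (LINT s|M. f s)" for n using Ir[of n] Ir0[of n] by simp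
  then have sd: "summable d" using d by (intro summableI_nonneg_bounded)
  have dec: "decseq (\<lambda>n. r n s)" for s
    using d v' by (intro decseq_SucI) (simp add: rS)
  have "\<exists>l. (\<lambda>n. r n s) \<longlonglongrightarrow> l \<and> (\<forall>n. l \<le> r n s)" for s
    using decseq_convergent[OF dec, of 0 s] r by metis
  then obtain q where q: "\<And>s. (\<lambda>n. r n s) \<longlonglongrightarrow> q s" "\<And>s n. q s \<le> r n s" by metis
  have q0: "0 \<le> q s" for s using r by (intro LIMSEQ_le_const[OF q(1)]) auto
  have qm: "q \<in> borel_measurable M"
    by (rule borel_measurable_LIMSEQ_real[OF q(1)]) (use r in auto)
  have bd: "norm (r n s) \<le> f s" for n s
    using decseqD[OF dec, of 0 n s] r by auto
  have qi: "integrable M q"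
    by (rule integrable_dominated_convergence[OF qm, of r f]) (use r q bd f in auto)
  have lim: "(\<lambda>n. LINT s|M. r n s) \<longlonglongrightarrow> (LINT s|M. q s)"
    by (rule integral_dominated_convergence[OF qm, of r f]) (use r q bd f in auto)
  have "(LINT s|M. q s) = 0"
  proof (rule ccontr)
    assume "(LINT s|M. q s) \<noteq> 0"
    then have "0 < (LINT s|M. q s)" using q0 by (simp add: less_le)
    then obtain d' v' where d': "0 < d'" "unit_atom v'" "\<And>s. d' * v' s \<le> q s"
      using unit_atom_below[OF qi q0] by blast
    have "d' \<le> 2 * d n" for n
      using d' q(2) by (intro max[of d' v']) (auto intro: order_trans)
    moreover have "(\<lambda>n. 2 * d n) \<longlonglongrightarrow> 2 * 0" by (intro tendsto_mult_left summable_LIMSEQ_zero sd)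
    ultimately have "d' \<le> 2 * 0" by (intro LIMSEQ_le_const[of "\<lambda>n. 2 * d n"]) auto
    then show False using d' by simp
  qed
  then have "(\<lambda>n. norm (T (r n))) \<longlonglongrightarrow> 0" using lim r by (simp add: norm_T_nonneg)
  then have "(\<lambda>n. T (r n)) \<longlonglongrightarrow> 0" by (rule tendsto_norm_zero_cancel)
  then have "(\<lambda>n. T f - T (r n)) \<longlonglongrightarrow> T f - 0" by (intro tendsto_diff tendsto_const)
  then have "(\<lambda>n. d n *\<^sub>R T (v n)) sums T f" by (simp add: sums_def Tr)
  then show thesis using that[of d "\<lambda>n. T (v n)"] d v sd by (auto simp: atom_set_def)
qed

section \<open>Synthesis from coefficients on the atoms\<close>

definition synthesis :: "('b \<Rightarrow> real) \<Rightarrow> 'b" where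
  "synthesis c = (\<Sum>\<^sub>\<infinity>e\<in>atom_set. c e *\<^sub>R e)"

lemma has_sum_synthesis:
  assumes "c \<in> l1_space atom_set"
  shows "((\<lambda>e. c e *\<^sub>R e) has_sum synthesis c) atom_set"
proof -
  have "(\<lambda>e. norm (c e *\<^sub>R e)) summable_on atom_set \<longleftrightarrow> (\<lambda>e. \<bar>c e\<bar>) summable_on atom_set"
    by (intro summable_on_cong) (simp add: norm_atom_set)
  then show ?thesis
    using assms abs_summable_summable[of "\<lambda>e. c e *\<^sub>R e" atom_set]
    unfolding synthesis_def l1_space_def by simp
qed

text \<open>The identity for finite sums passes to the limit along the finite subsets of
  \<open>atom_set\<close>.\<close>

lemma norm_synthesis:
  assumes "c \<in> l1_space atom_set"
  shows "norm (synthesis c) = (\<Sum>\<^sub>\<infinity>e\<in>atom_set. \<bar>c e\<bar>)"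
proof -
  have "((\<lambda>F. norm (\<Sum>e\<in>F. c e *\<^sub>R e)) \<longlongrightarrow> norm (synthesis c)) (finite_subsets_at_top atom_set)"
    using has_sum_synthesis[OF assms] unfolding has_sum_def by (rule tendsto_norm)
  moreover have "\<forall>\<^sub>F F in finite_subsets_at_top atom_set.
      norm (\<Sum>e\<in>F. c e *\<^sub>R e) = (\<Sum>e\<in>F. \<bar>c e\<bar>)"
    by (intro eventually_finite_subsets_at_top_weakI norm_sum_atom_set)
  ultimately have "((\<lambda>e. \<bar>c e\<bar>) has_sum norm (synthesis c)) atom_set"
    unfolding has_sum_def by (rule Lim_transform_eventually)
  then show ?thesis by (simp add: infsumI)
qed

lemma synthesis_eqI:
  assumes "c \<in> l1_space atom_set" "((\<lambda>e. c e *\<^sub>R e) has_sum b) atom_set"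
  shows "synthesis c = b"
  using has_sum_unique[OF has_sum_synthesis[OF assms(1)] assms(2)] .

lemma synthesis_add:
  assumes "f \<in> l1_space atom_set" "g \<in> l1_space atom_set"
  shows "synthesis (\<lambda>i. f i + g i) = synthesis f + synthesis g"
  using has_sum_add[OF has_sum_synthesis has_sum_synthesis, OF assms] assms
  by (intro synthesis_eqI l1_space_add) (auto simp: scaleR_left_distrib)

text \<open>If the family for \<open>f\<close> is not summable, both sides are \<open>0\<close>, the
  default value of \<open>infsum\<close>.\<close>

lemma synthesis_scale: "synthesis (\<lambda>i. c * f i) = c *\<^sub>R synthesis f"
  unfolding synthesis_def by (simp only: scaleR_scaleR[symmetric] infsum_scaleR_right)

lemma T_nonneg_in_synthesis:
  assumes f: "integrable M f" "\<And>s. 0 \<le> f s"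
  shows "T f \<in> synthesis ` l1_space atom_set"
proof (cases "(LINT s|M. f s) = 0")
  case True
  then have "T f = 0" using f norm_T_nonneg[of f] by simp
  then have "T f = synthesis (\<lambda>_. 0)" by (simp add: synthesis_def)
  moreover have "(\<lambda>_. 0) \<in> l1_space atom_set" by (simp add: l1_space_def)
  ultimately show ?thesis by blast
next
  case False
  then have pos: "0 < (LINT s|M. f s)" using f by (simp add: less_le)
  obtain d e where d: "\<And>n::nat. 0 \<le> d n" and e: "\<And>n. e n \<in> atom_set" and sd: "summable d"
    and sums: "(\<lambda>n. d n *\<^sub>R e n) sums T f"
    by (rule atomic_expansion[OF f pos]) blast
  \<comment> \<open>The expansion may use an atom repeatedly, so coefficients are collected over the
    indices of each atom; indexing by pairs \<open>(e n, n)\<close> lets the series be summed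
    fibrewise.\<close>
  define B where "B x = {n. e n = x}" for x
  define c where "c x = infsum d (B x)" for x
  have bij: "bij_betw (\<lambda>n. (e n, n)) UNIV (Sigma atom_set B)"
    using e by (auto simp: bij_betw_def inj_on_def B_def)
  have hd: "(d has_sum suminf d) UNIV"
    using sd d by (intro norm_summable_imp_has_sum) (auto intro: summable_sums)
  have "((\<lambda>n. d n *\<^sub>R e n) has_sum T f) UNIV"
    using sd d e by (intro norm_summable_imp_has_sum sums) (simp add: norm_atom_set)
  then have *: "((\<lambda>(x, n). d n *\<^sub>R x) has_sum T f) (Sigma atom_set B)"
    using has_sum_reindex_bij_betw[OF bij, of "\<lambda>(x, n). d n *\<^sub>R x" "T f"] by simp
  have **: "((\<lambda>(x, n). d n) has_sum suminf d) (Sigma atom_set B)"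
    using hd has_sum_reindex_bij_betw[OF bij, of "\<lambda>(x, n). d n" "suminf d"] by simp
  have dB: "(d has_sum c x) (B x)" for x
    unfolding c_def using has_sum_imp_summable[OF hd] by (intro has_sum_infsum) (auto intro: summable_on_subset_banach)
  have "(c has_sum suminf d) atom_set"
    by (rule has_sum_SigmaD[OF **]) (use dB in auto)
  then have "c summable_on atom_set" by (rule has_sum_imp_summable)
  moreover have "0 \<le> c x" for x unfolding c_def using d by (intro infsum_nonneg)
  ultimately have abs: "(\<lambda>x. \<bar>c x\<bar>) summable_on atom_set" by simp
  have sum: "((\<lambda>x. c x *\<^sub>R x) has_sum T f) atom_set"
  proof (rule has_sum_SigmaD[OF *])
    fix x
    show "((\<lambda>n. case (x, n) of (x, n) \<Rightarrow> d n *\<^sub>R x) has_sum c x *\<^sub>R x) (B x)"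
      using has_sum_bounded_linear[OF bounded_linear_scaleR_left dB] by simp
  qed
  define c' where "c' x = (if x \<in> atom_set then c x else 0)" for x
  have "(\<lambda>x. \<bar>c' x\<bar>) summable_on atom_set \<longleftrightarrow> (\<lambda>x. \<bar>c x\<bar>) summable_on atom_set"
    by (intro summable_on_cong) (simp add: c'_def)
  then have "c' \<in> l1_space atom_set" using abs by (simp add: l1_space_def c'_def)
  moreover have "((\<lambda>x. c' x *\<^sub>R x) has_sum T f) atom_set \<longleftrightarrow> ((\<lambda>x. c x *\<^sub>R x) has_sum T f) atom_set"
    by (intro has_sum_cong) (simp add: c'_def)
  ultimately show ?thesis using synthesis_eqI[of c' "T f"] sum by (metis imageI)
qed

theorem isometric_to_l1_atom_set: "isometric_to_l1 TYPE('b) atom_set"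
proof -
  have "b \<in> synthesis ` l1_space atom_set" for b
  proof -
    obtain f where f: "integrable M f" "T f = b" using surj_T by metis
    \<comment> \<open>Surjectivity is reduced to nonnegative functions through the positive and
      negative parts.\<close>
    have "T (\<lambda>s. max (f s) 0) \<in> synthesis ` l1_space atom_set"
      "T (\<lambda>s. max (- f s) 0) \<in> synthesis ` l1_space atom_set"
      using f by (auto intro!: T_nonneg_in_synthesis)
    then obtain p n where pn: "p \<in> l1_space atom_set" "T (\<lambda>s. max (f s) 0) = synthesis p"
      "n \<in> l1_space atom_set" "T (\<lambda>s. max (- f s) 0) = synthesis n" by blast
    have "f = (\<lambda>s. max (f s) 0 - max (- f s) 0)" by auto
    then have "b = synthesis p - synthesis n"
      using T_diff[of "\<lambda>s. max (f s) 0" "\<lambda>s. max (- f s) 0"] f pn by auto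
    also have "\<dots> = synthesis (\<lambda>i. p i + (- 1) * n i)"
      using pn l1_space_scale[OF pn(3), of "- 1"] by (subst synthesis_add) (auto simp only: synthesis_scale, simp)
    finally show ?thesis using pn l1_space_add l1_space_scale by blast
  qed
  then show ?thesis
    unfolding isometric_to_l1_def
    by (intro exI[of _ synthesis]) (auto simp: synthesis_add synthesis_scale norm_synthesis)
qed

end

section \<open>Combination of the two conclusions\<close>

theorem theorem8:
  assumes "L1_predual TYPE('a::banach) TYPE('m)"
    and "\<And>x::'a. norm x = 1 \<Longrightarrow> ssd_at x"
  shows "quasi_polyhedral TYPE('a) \<and> dual_is_l1 TYPE('a)"
proof -
  obtain M :: "'m measure" where "isometric_to_L1 TYPE('a \<Rightarrow>\<^sub>L real) M"
    using assms(1) unfolding L1_predual_def by blast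
  then obtain T :: "('m \<Rightarrow> real) \<Rightarrow> ('a \<Rightarrow>\<^sub>L real)" where
    "\<forall>f g. integrable M f \<longrightarrow> integrable M g \<longrightarrow> T (\<lambda>s. f s + g s) = T f + T g"
    "\<forall>c f. integrable M f \<longrightarrow> T (\<lambda>s. c * f s) = c *\<^sub>R T f"
    "\<forall>f. integrable M f \<longrightarrow> norm (T f) = (LINT s|M. \<bar>f s\<bar>)"
    "T ` {f. integrable M f} = UNIV"
    unfolding isometric_to_L1_def by blast
  then interpret L1_dual M T by unfold_locales (auto simp: image_def set_eq_iff, metis)
  interpret atomic_L1 M T
    by unfold_locales (use exists_L1_atom_below[OF assms(2)] in blast)
  show ?thesis
    using norm_medians_imp_quasi_polyhedral[OF norm_medians assms(2)] isometric_to_l1_atom_set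
    unfolding dual_is_l1_def by blast
qed

end
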